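(* Let $\psi\in C^1(\mathbb{R})$ satisfy: $\psi(0)=1$, $\psi$ is even, there exist $C>0$ and $\delta>1$ with $|\psi(x)|+|x\psi'(x)|\leq C\langle x\rangle^{-\delta}$ for all $x\in\mathbb{R}$, and $A_\psi:=\int_{\mathbb{R}}\psi(x)\,\mathrm{d}x\neq 0$. Let $\mu$ be a probability measure on $\mathbb{R}$ and $(c,d)$ a bounded interval. Then: 1. With $C=\int_{\mathbb{R}}|\psi(x)|^2\,\mathrm{d}x$, $$\lim_{a\to0}\frac{1}{a}\int_c^d|(\psi_a*\mu)(x)|^2\,\mathrm{d}x=C\Big(\sum_{x\in(c,d)}\mu(\{x\})^2+\tfrac12\big[\mu(\{c\})^2+\mu(\{d\})^2\big]\Big).$$ 2. For $0<p<1$, $$\lim_{a\to0}\int_c^d|(\tilde{\psi}_a*\mu)(x)|^p\,\mathrm{d}x=|A_\psi|^p\int_c^d\Big|\frac{\mathrm{d}\mu_{\rm ac}}{\mathrm{d}x}(x)\Big|^p\,\mathrm{d}x.$$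
   Context: $\langle x\rangle=(1+x^2)^{1/2}$. For $a>0$, $\psi_a(x)=\psi(x/a)$ and $\tilde{\psi}_a(x)=\frac{1}{a}\psi_a(x)$. The convolution is $(f*\mu)(x)=\int f(x-y)\,\mathrm{d}\mu(y)$. $\mu_{\rm ac}$ denotes the absolutely continuous part (with respect to Lebesgue measure) of $\mu$ in its Lebesgue decomposition, and $\mathrm{d}\mu_{\rm ac}/\mathrm{d}x$ its Radon–Nikodym derivative. Limits $a\to0$ are over $a>0$. *)

theory Defs
  imports "HOL-Probability.Probability"
begin

definition jbr :: "real \<Rightarrow> real" where
  "jbr x = sqrt (1 + x\<^sup>2)"

definition conv_meas :: "(real \<Rightarrow> real) \<Rightarrow> real measure \<Rightarrow> real \<Rightarrow> real" where
  "conv_meas f M x = (LINT y|M. f (x - y))"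

text \<open>Radon-Nikodym derivative (w.r.t. Lebesgue measure) of the absolutely continuous part
  of M in its Lebesgue decomposition M = mu_ac + mu_s, where mu_ac(A) = integral over A of g
  and mu_s(A) = M(A \<inter> N) is concentrated on a Lebesgue-null Borel set N.\<close>
definition ac_density :: "real measure \<Rightarrow> real \<Rightarrow> real" where
  "ac_density M = (SOME g. g \<in> borel_measurable borel \<and> (\<forall>x. 0 \<le> g x) \<and>
     (\<exists>N\<in>sets borel. emeasure lborel N = 0 \<and>
        (\<forall>A\<in>sets borel. emeasure M A = (\<integral>\<^sup>+x\<in>A. ennreal (g x) \<partial>lborel) + emeasure M (A \<inter> N))))"

end

theory Submission
  imports Defs
begin

text \<open>
  For the first limit, expand one of the two factors \<open>\<psi>\<^sub>a * \<mu>\<close> and substitute \<open>x = y + a u\<close>: the integral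
  becomes an average over \<open>y\<close> (with respect to \<open>\<mu>\<close>) and \<open>u\<close> of \<open>\<psi> u (\<psi>\<^sub>a * \<mu>) (y + a u)\<close>, restricted to
  \<open>y + a u \<in> (c, d)\<close>. Since \<open>\<psi>\<close> vanishes at infinity, \<open>(\<psi>\<^sub>a * \<mu>) (y + a u)\<close> tends to \<open>\<psi> u \<mu>{y}\<close>,
  and at an end point of the interval only one half-line of \<open>u\<close> survives, which yields the factor
  \<open>1/2\<close> by evenness. Dominated convergence does the rest.

  For the second limit no differentiation theorem is needed. Up to an error that is small in \<open>L\<^sup>1\<close>, the
  measure is \<open>\<phi> dx\<close> plus a part carried by a compact null set \<open>K\<close>, with \<open>\<phi>\<close> bounded and continuous. The
  mollification of \<open>\<phi> dx\<close> converges in \<open>L\<^sup>1(c, d)\<close>, and that of the other part converges to \<open>0\<close> uniformly off any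
  neighbourhood \<open>U\<close> of \<open>K\<close>. As \<open>p < 1\<close>, convergence in \<open>L\<^sup>1\<close> off sets \<open>U\<close> of arbitrarily small measure,
  together with a bound in \<open>L\<^sup>1\<close>, implies convergence in \<open>L\<^sup>p\<close>.
\<close>

section \<open>Integration lemmas\<close>

lemma integral_dominated_convergence_at_right:
  fixes s :: "real \<Rightarrow> 'a \<Rightarrow> real" and f w :: "'a \<Rightarrow> real"
  assumes f: "f \<in> borel_measurable M"
    and s: "\<And>a. a > 0 \<Longrightarrow> s a \<in> borel_measurable M"
    and w: "integrable M w"
    and lim: "AE x in M. ((\<lambda>a. s a x) \<longlongrightarrow> f x) (at_right 0)"
    and bound: "\<And>a. a > 0 \<Longrightarrow> AE x in M. norm (s a x) \<le> w x"
  shows "((\<lambda>a. integral\<^sup>L M (s a)) \<longlongrightarrow> integral\<^sup>L M f) (at_right 0)"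
  unfolding tendsto_at_iff_sequentially comp_def
proof (intro allI impI)
  fix X :: "nat \<Rightarrow> real"
  assume X: "\<forall>i. X i \<in> {0<..} - {0}" "X \<longlonglongrightarrow> 0"
  show "(\<lambda>i. integral\<^sup>L M (s (X i))) \<longlonglongrightarrow> integral\<^sup>L M f"
  proof (rule integral_dominated_convergence[OF f _ w])
    show "AE x in M. (\<lambda>i. s (X i) x) \<longlonglongrightarrow> f x"
      using lim
    proof eventually_elim
      case (elim x)
      then show ?case
        using X unfolding tendsto_at_iff_sequentially comp_def by blast
    qed
  qed (use X s bound in auto)
qed

lemma powr_le_affine:
  fixes h s p :: real
  assumes "0 \<le> h" "0 < s" "0 < p" "p < 1"
  shows "h powr p \<le> s powr p + s powr (p - 1) * h"
proof (cases "h \<le> s")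
  case True
  then have "h powr p \<le> s powr p"
    using assms by (intro powr_mono2) auto
  then show ?thesis
    using assms by (auto intro: add_increasing2)
next
  case False
  then have "h powr p = h powr (p - 1) * h"
    using assms by (simp add: powr_mult_base mult.commute)
  also have "\<dots> \<le> s powr (p - 1) * h"
    using False assms by (intro mult_right_mono powr_mono2') auto
  finally show ?thesis
    by (auto intro: add_increasing)
qed

lemma powr_add_le:
  fixes u v p :: real
  assumes "0 \<le> u" "0 \<le> v" "0 < p" "p < 1"
  shows "(u + v) powr p \<le> u powr p + v powr p"
proof (cases "u = 0 \<or> v = 0")
  case False
  then have pos: "0 < u" "0 < v" using assms by auto
  have "(u + v) powr p = u * (u + v) powr (p - 1) + v * (u + v) powr (p - 1)"
    using pos powr_mult_base[of "u + v" "p - 1"] by (simp add: distrib_right)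
  also have "\<dots> \<le> u * u powr (p - 1) + v * v powr (p - 1)"
    using pos assms by (intro add_mono mult_left_mono powr_mono2') auto
  also have "\<dots> = u powr p + v powr p"
    using pos by (simp add: powr_mult_base)
  finally show ?thesis .
qed (use assms in auto)

lemma abs_powr_diff_le:
  fixes x y p :: real
  assumes p: "0 < p" "p < 1"
  shows "\<bar>\<bar>x\<bar> powr p - \<bar>y\<bar> powr p\<bar> \<le> \<bar>x - y\<bar> powr p"
proof -
  have "\<bar>x\<bar> powr p \<le> \<bar>y\<bar> powr p + \<bar>x - y\<bar> powr p" for x y :: real
  proof -
    have "\<bar>x\<bar> powr p \<le> (\<bar>y\<bar> + \<bar>x - y\<bar>) powr p"
      using p by (intro powr_mono2) auto
    also have "\<dots> \<le> \<bar>y\<bar> powr p + \<bar>x - y\<bar> powr p"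
      using p by (intro powr_add_le) auto
    finally show ?thesis .
  qed
  from this[of x y] this[of y x] show ?thesis
    unfolding abs_minus_commute[of y x] by linarith
qed

lemma eventually_nn_integral_powr_le:
  fixes D :: "'i \<Rightarrow> 'a \<Rightarrow> real" and p b :: real
  assumes I [measurable]: "I \<in> sets M" and I_fin: "emeasure M I < \<infinity>"
    and D: "\<And>a. D a \<in> borel_measurable M"
    and p: "0 < p" "p < 1"
    and bound: "\<forall>\<^sub>F a in F. (\<integral>\<^sup>+x. ennreal (\<bar>D a x\<bar> * indicator I x) \<partial>M) \<le> ennreal b"
    and small: "\<And>e::real. 0 < e \<Longrightarrow> \<exists>U\<in>sets M. emeasure M U \<le> ennreal e \<and>
      (\<forall>\<^sub>F a in F. (\<integral>\<^sup>+x. ennreal (\<bar>D a x\<bar> * indicator (I - U) x) \<partial>M) \<le> ennreal e)"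
    and e: "0 < (e::real)"
  shows "\<forall>\<^sub>F a in F. (\<integral>\<^sup>+x. ennreal (\<bar>D a x\<bar> powr p * indicator I x) \<partial>M) \<le> ennreal e"
proof -
  define m where "m = measure M I"
  have m: "0 \<le> m" "emeasure M I = ennreal m"
    using I_fin by (auto simp: m_def emeasure_eq_ennreal_measure)
  txt \<open>The affine bound on \<open>\<bar>D\<bar> powr p\<close> is used with the large constant \<open>S\<close> on \<open>U\<close> and the small
    constant \<open>s\<close> off \<open>U\<close>.\<close>
  define s where "s = (e / (4 * (m + 1))) powr (1 / p)"
  define S where "S = (e / (4 * (\<bar>b\<bar> + 1))) powr (1 / (p - 1))"
  have s: "0 < s" "s powr p = e / (4 * (m + 1))"
    using e m p by (auto simp: s_def powr_powr)
  have S: "0 < S" "S powr (p - 1) = e / (4 * (\<bar>b\<bar> + 1))"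
    using e p by (auto simp: S_def powr_powr)
  define \<eta> where "\<eta> = min (e / 4 / S powr p) (e / 4 / s powr (p - 1))"
  have \<eta>: "0 < \<eta>" "S powr p * \<eta> \<le> e / 4" "s powr (p - 1) * \<eta> \<le> e / 4"
    using e s(1) S(1) by (auto simp: \<eta>_def min_def field_simps)
  obtain U where U[measurable]: "U \<in> sets M" and U_small: "emeasure M U \<le> ennreal \<eta>"
    and ev: "\<forall>\<^sub>F a in F. (\<integral>\<^sup>+x. ennreal (\<bar>D a x\<bar> * indicator (I - U) x) \<partial>M) \<le> ennreal \<eta>"
    using small[OF \<eta>(1)] by auto
  have sm: "s powr p * m \<le> e / 4"
    unfolding s(2) using m e by (simp add: field_simps)
  have Sb: "S powr (p - 1) * \<bar>b\<bar> \<le> e / 4"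
    unfolding S(2) using e by (simp add: field_simps)
  show ?thesis
    using bound ev
  proof eventually_elim
    case (elim a)
    note [measurable] = D[of a]
    have pt: "\<bar>D a x\<bar> powr p * indicator I x \<le> (S powr p * indicator U x + S powr (p - 1) * (\<bar>D a x\<bar> * indicator I x))
        + (s powr p * indicator I x + s powr (p - 1) * (\<bar>D a x\<bar> * indicator (I - U) x))" for x
    proof -
      have nn: "0 \<le> S powr (p - 1) * \<bar>D a x\<bar>" "0 \<le> s powr (p - 1) * \<bar>D a x\<bar>" "0 \<le> s powr p" "0 \<le> S powr p"
        by simp_all
      have "\<bar>D a x\<bar> powr p \<le> S powr p + S powr (p - 1) * \<bar>D a x\<bar>"
        "\<bar>D a x\<bar> powr p \<le> s powr p + s powr (p - 1) * \<bar>D a x\<bar>"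
        using s(1) S(1) p by (auto intro!: powr_le_affine)
      then show ?thesis
        by (cases "x \<in> U"; cases "x \<in> I"; simp add: indicator_def; use nn in linarith)
    qed
    have "(\<integral>\<^sup>+x. ennreal (\<bar>D a x\<bar> powr p * indicator I x) \<partial>M)
      \<le> (\<integral>\<^sup>+x. (ennreal (S powr p) * indicator U x + ennreal (S powr (p - 1)) * ennreal (\<bar>D a x\<bar> * indicator I x))
        + (ennreal (s powr p) * indicator I x + ennreal (s powr (p - 1)) * ennreal (\<bar>D a x\<bar> * indicator (I - U) x)) \<partial>M)"
    proof (rule nn_integral_mono)
      fix x
      show "ennreal (\<bar>D a x\<bar> powr p * indicator I x) \<le> (ennreal (S powr p) * indicator U x + ennreal (S powr (p - 1)) * ennreal (\<bar>D a x\<bar> * indicator I x))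
        + (ennreal (s powr p) * indicator I x + ennreal (s powr (p - 1)) * ennreal (\<bar>D a x\<bar> * indicator (I - U) x))"
        using ennreal_leI[OF pt[of x]]
        by (simp add: ennreal_mult ennreal_indicator)
    qed
    also have "\<dots> = (ennreal (S powr p) * emeasure M U + ennreal (S powr (p - 1)) * (\<integral>\<^sup>+x. ennreal (\<bar>D a x\<bar> * indicator I x) \<partial>M))
        + (ennreal (s powr p) * emeasure M I + ennreal (s powr (p - 1)) * (\<integral>\<^sup>+x. ennreal (\<bar>D a x\<bar> * indicator (I - U) x) \<partial>M))"
      by (simp add: nn_integral_add nn_integral_cmult)
    also have "\<dots> \<le> (ennreal (S powr p) * ennreal \<eta> + ennreal (S powr (p - 1)) * ennreal \<bar>b\<bar>)
        + (ennreal (s powr p) * ennreal m + ennreal (s powr (p - 1)) * ennreal \<eta>)"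
      unfolding m(2)[symmetric]
      by (intro add_mono mult_left_mono U_small elim order.trans[OF elim(1) ennreal_leI] order.refl) auto
    also have "\<dots> = ennreal ((S powr p * \<eta> + S powr (p - 1) * \<bar>b\<bar>) + (s powr p * m + s powr (p - 1) * \<eta>))"
      using \<eta>(1) m(1) by (simp add: ennreal_mult)
    also have "\<dots> \<le> ennreal e"
      using \<eta> sm Sb by (intro ennreal_leI) linarith
    finally show ?case .
  qed
qed

lemma integrable_approx_continuous:
  fixes f :: "'a::euclidean_space \<Rightarrow> real"
  assumes "integrable lborel f" "0 < e"
  shows "\<exists>\<phi> C. continuous_on UNIV \<phi> \<and> (\<forall>x. \<bar>\<phi> x\<bar> \<le> C) \<and> integrable lborel \<phi>
    \<and> (LINT x|lborel. \<bar>f x - \<phi> x\<bar>) < e"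
  using assms
proof (induction arbitrary: e rule: integrable_induct)
  case (base A c)
  have A[measurable]: "A \<in> sets borel" using base(1) by simp
  define r where "r = e / (2 * (\<bar>c\<bar> + 1))"
  have r: "0 < r" using base(3) by (simp add: r_def)
  obtain U where U: "open U" "A \<subseteq> U" "emeasure lborel (U - A) < ennreal r"
    using outer_regular_lborel[OF A r] by blast
  obtain T where T: "closed T" "T \<subseteq> A" "emeasure lebesgue (A - T) < ennreal r"
    using sets_lebesgue_inner_closed[OF sets_completionI_sets r] A by (metis sets_lborel)
  have [measurable]: "U \<in> sets borel" "T \<in> sets borel"
    using U T by auto
  have AT: "emeasure lborel (A - T) < ennreal r"
    using T(3) by simp
  have "U - T = (U - A) \<union> (A - T)" using U T by auto
  then have "emeasure lborel (U - T) \<le> emeasure lborel (U - A) + emeasure lborel (A - T)"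
    using emeasure_subadditive[of "U - A" lborel "A - T"] by simp
  also have "\<dots> < ennreal r + ennreal r"
    using U(3) AT by (rule add_strict_mono)
  finally have UT: "emeasure lborel (U - T) < ennreal (2 * r)"
    using r by (simp flip: ennreal_plus)
  have "emeasure lborel U \<le> emeasure lborel (U - A) + emeasure lborel A"
    using emeasure_subadditive[of "U - A" lborel A] U by (auto simp: Un_absorb2)
  also have "\<dots> < \<infinity>"
    using order.strict_trans[OF U(3) ennreal_less_top] base(2) by (simp add: less_top)
  finally have U_fin: "emeasure lborel U < \<infinity>" .
  obtain h :: "'a \<Rightarrow> real" where h: "continuous_on UNIV h" "\<And>x. h x \<in> closed_segment 1 0"
    "\<And>x. x \<in> T \<Longrightarrow> h x = 1" "\<And>x. x \<in> - U \<Longrightarrow> h x = 0"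
  proof (rule Urysohn[of T "- U" 1 "0::real"])
    show "T \<inter> - U = {}" using T U by auto
  qed (use T U in auto)
  have h01: "0 \<le> h x" "h x \<le> 1" for x
    using h(2)[of x] by (auto simp: closed_segment_eq_real_ivl)
  have [measurable]: "h \<in> borel_measurable borel"
    using h(1) by (rule borel_measurable_continuous_onI)
  have int_h: "integrable lborel h"
    by (rule integrableI_bounded_set[where A = U and B = 1]) (use U_fin h01 h(4) in auto)
  have int_A: "integrable lborel (\<lambda>x. indicator A x *\<^sub>R c)"
    using base by simp
  have int_UT: "integrable lborel (\<lambda>x. \<bar>c\<bar> * indicat_real (U - T) x)"
    using UT by (auto intro!: integrable_real_indicator simp: less_top elim: order.strict_trans)
  have pt: "\<bar>indicator A x *\<^sub>R c - c * h x\<bar> \<le> \<bar>c\<bar> * indicator (U - T) x" for x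
  proof -
    have "\<bar>indicator A x - h x\<bar> \<le> indicator (U - T) x"
      using h01[of x] h(3)[of x] h(4)[of x] U(2) T(2) by (auto split: split_indicator)
    then have "\<bar>c\<bar> * \<bar>indicator A x - h x\<bar> \<le> \<bar>c\<bar> * indicator (U - T) x"
      by (rule mult_left_mono) simp
    then show ?thesis by (simp add: abs_mult[symmetric] algebra_simps)
  qed
  have "(LINT x|lborel. \<bar>indicator A x *\<^sub>R c - c * h x\<bar>) \<le> (LINT x|lborel. \<bar>c\<bar> * indicat_real (U - T) x)"
    by (intro integral_mono int_UT integrable_abs Bochner_Integration.integrable_diff int_A integrable_mult_right int_h pt)
  also have "\<dots> = \<bar>c\<bar> * measure lborel (U - T)"
    by simp
  also have "\<dots> \<le> \<bar>c\<bar> * (2 * r)"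
    using UT r by (intro mult_left_mono) (auto simp: measure_def enn2real_leI less_imp_le)
  also have "\<dots> < e"
    using base(3) by (simp add: r_def field_simps)
  finally show ?case
    using h01 h(1) int_h
    by (intro exI[of _ "\<lambda>x. c * h x"] exI[of _ "\<bar>c\<bar>"])
      (auto simp: abs_mult mult_left_le intro!: continuous_intros)
next
  case (add f g)
  obtain \<phi> C where \<phi>: "continuous_on UNIV \<phi>" "\<And>x. \<bar>\<phi> x\<bar> \<le> C" "integrable lborel \<phi>"
    "(LINT x|lborel. \<bar>f x - \<phi> x\<bar>) < e / 2"
    using add.IH(1)[of "e / 2"] add.prems by auto
  obtain \<gamma> C' where \<gamma>: "continuous_on UNIV \<gamma>" "\<And>x. \<bar>\<gamma> x\<bar> \<le> C'" "integrable lborel \<gamma>"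
    "(LINT x|lborel. \<bar>g x - \<gamma> x\<bar>) < e / 2"
    using add.IH(2)[of "e / 2"] add.prems by auto
  have "(LINT x|lborel. \<bar>(f x + g x) - (\<phi> x + \<gamma> x)\<bar>) \<le> (LINT x|lborel. \<bar>f x - \<phi> x\<bar> + \<bar>g x - \<gamma> x\<bar>)"
    using add.hyps \<phi>(3) \<gamma>(3) by (intro integral_mono) auto
  also have "\<dots> < e"
    using add.hyps \<phi>(3,4) \<gamma>(3,4) by simp
  finally show ?case
    using \<phi> \<gamma>
    by (intro exI[of _ "\<lambda>x. \<phi> x + \<gamma> x"] exI[of _ "C + C'"])
      (auto intro!: continuous_intros order.trans[OF abs_triangle_ineq] add_mono)
next
  case (lim f s)
  have "(\<lambda>i. LINT x|lborel. \<bar>f x - s i x\<bar>) \<longlonglongrightarrow> (LINT x|(lborel :: 'a measure). (0::real))"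
  proof (rule integral_dominated_convergence[where w = "\<lambda>x. 3 * \<bar>f x\<bar>"])
    show "AE x in lborel. (\<lambda>i. \<bar>f x - s i x\<bar>) \<longlonglongrightarrow> 0"
    proof (rule AE_I2)
      fix x :: 'a
      have "(\<lambda>i. \<bar>f x - s i x\<bar>) \<longlonglongrightarrow> \<bar>f x - f x\<bar>"
        by (intro tendsto_intros lim.hyps(2)) simp
      then show "(\<lambda>i. \<bar>f x - s i x\<bar>) \<longlonglongrightarrow> 0" by simp
    qed
    show "AE x in lborel. norm \<bar>f x - s i x\<bar> \<le> 3 * \<bar>f x\<bar>" for i
    proof (rule AE_I2)
      fix x :: 'a
      show "norm \<bar>f x - s i x\<bar> \<le> 3 * \<bar>f x\<bar>"
        using lim.hyps(3)[of x i] by auto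
    qed
  qed (use lim.hyps in auto)
  then have "\<forall>\<^sub>F i in sequentially. (LINT x|lborel. \<bar>f x - s i x\<bar>) < e / 2"
    using lim.prems by (intro order_tendstoD(2)) auto
  then obtain i where i: "(LINT x|lborel. \<bar>f x - s i x\<bar>) < e / 2"
    by (auto simp: eventually_sequentially)
  obtain \<phi> C where \<phi>: "continuous_on UNIV \<phi>" "\<forall>x. \<bar>\<phi> x\<bar> \<le> C" "integrable lborel \<phi>"
    "(LINT x|lborel. \<bar>s i x - \<phi> x\<bar>) < e / 2"
    using lim.IH[of "e / 2" i] lim.prems by auto
  have "(LINT x|lborel. \<bar>f x - \<phi> x\<bar>) \<le> (LINT x|lborel. \<bar>f x - s i x\<bar> + \<bar>s i x - \<phi> x\<bar>)"
    using lim.hyps \<phi>(3) by (intro integral_mono) auto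
  also have "\<dots> < e"
    using lim.hyps \<phi>(3,4) i by simp
  finally show ?case
    using \<phi> by blast
qed

section \<open>Atoms and the absolutely continuous part\<close>

context finite_borel_measure
begin

declare M_is_borel [measurable_cong]

lemma space_eq_UNIV [simp]: "space M = UNIV"
  using sets_eq_imp_space_eq[OF M_is_borel] by simp

lemma measurable_atom_mass [measurable]: "(\<lambda>y. measure M {y}) \<in> borel_measurable borel"
proof -
  have "(\<lambda>y. LINT z|M. (if y = z then 1 else 0 :: real)) \<in> borel_measurable borel"
    by measurable
  moreover have "(LINT z|M. (if y = z then 1 else 0)) = measure M {y}" for y
  proof -
    have "(LINT z|M. (if y = z then 1 else 0)) = (LINT z|M. indicat_real {y} z)"
      by (intro Bochner_Integration.integral_cong) auto
    then show ?thesis by simp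
  qed
  ultimately show ?thesis by simp
qed

lemma integral_atom_mass:
  assumes S[measurable]: "S \<in> sets borel"
  shows "(LINT y|M. indicator S y * measure M {y}) = (\<Sum>\<^sub>\<infinity>y\<in>S. (measure M {y})\<^sup>2)"
proof -
  define T where "T = S \<inter> {x. measure M {x} \<noteq> 0}"
  have T: "countable T"
    unfolding T_def using countable_support by blast
  have "(\<integral>\<^sup>+y. ennreal (indicator S y * measure M {y}) \<partial>M)
      = (\<integral>\<^sup>+y. \<integral>\<^sup>+i. ennreal (measure M {i}) * indicator {i} y \<partial>count_space T \<partial>M)"
  proof (rule nn_integral_cong)
    fix y
    have "(\<integral>\<^sup>+i. ennreal (measure M {i}) * indicator {i} y \<partial>count_space T)
        = (\<integral>\<^sup>+i. ennreal (measure M {y}) * indicator {y} i \<partial>count_space T)"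
      by (intro nn_integral_cong) (auto split: split_indicator)
    also have "\<dots> = ennreal (measure M {y}) * (\<integral>\<^sup>+i. indicator {y} i \<partial>count_space T)"
      by (rule nn_integral_cmult) auto
    also have "\<dots> = ennreal (indicator S y * measure M {y})"
    proof (cases "y \<in> T")
      case True
      then show ?thesis by (simp add: T_def)
    next
      case False
      then have "(\<integral>\<^sup>+i. indicator {y} i \<partial>count_space T) = (\<integral>\<^sup>+i. 0 \<partial>count_space T)"
        by (intro nn_integral_cong) (auto simp: indicator_def)
      then show ?thesis using False by (auto simp: T_def split: split_indicator)
    qed
    finally show "ennreal (indicator S y * measure M {y})
      = (\<integral>\<^sup>+i. ennreal (measure M {i}) * indicator {i} y \<partial>count_space T)" by simp
  qed
  also have "\<dots> = (\<integral>\<^sup>+i. \<integral>\<^sup>+y. ennreal (measure M {i}) * indicator {i} y \<partial>M \<partial>count_space T)"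
    by (rule nn_integral_count_space_nn_integral[OF T]) measurable
  also have "\<dots> = (\<integral>\<^sup>+i. ennreal ((measure M {i})\<^sup>2) \<partial>count_space T)"
    by (intro nn_integral_cong)
      (auto simp: nn_integral_cmult emeasure_eq_measure power2_eq_square ennreal_mult)
  also have "\<dots> = (\<integral>\<^sup>+i. ennreal ((measure M {i})\<^sup>2) \<partial>count_space S)"
    by (rule nn_integral_count_space_eq) (auto simp: T_def)
  finally have nn: "(\<integral>\<^sup>+y. ennreal (indicator S y * measure M {y}) \<partial>M)
    = (\<integral>\<^sup>+i. ennreal ((measure M {i})\<^sup>2) \<partial>count_space S)" .
  have int: "integrable M (\<lambda>y. indicator S y * measure M {y})"
    by (rule integrable_const_bound[where B = "measure M UNIV"])
      (auto simp: bounded_measure[simplified] split: split_indicator)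
  have "Infinite_Set_Sum.abs_summable_on (\<lambda>i. (measure M {i})\<^sup>2) S"
    unfolding Infinite_Set_Sum.abs_summable_on_def
    using integrableD(2)[OF int] nn
    by (intro integrableI_bounded) (auto simp: less_top)
  then have "(\<Sum>\<^sub>\<infinity>y\<in>S. (measure M {y})\<^sup>2) = infsetsum (\<lambda>i. (measure M {i})\<^sup>2) S"
    by (simp add: infsetsum_infsum)
  also have "\<dots> = enn2real (\<integral>\<^sup>+i. ennreal ((measure M {i})\<^sup>2) \<partial>count_space S)"
    unfolding infsetsum_def by (intro integral_eq_nn_integral) auto
  also have "\<dots> = (LINT y|M. indicator S y * measure M {y})"
    unfolding nn[symmetric] by (intro integral_eq_nn_integral[symmetric]) auto
  finally show ?thesis by simp
qed

lemma ex_lebesgue_decomposition: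
  "\<exists>g. g \<in> borel_measurable borel \<and> (\<forall>x. 0 \<le> g x) \<and>
     (\<exists>N\<in>sets borel. emeasure lborel N = 0 \<and>
        (\<forall>A\<in>sets borel. emeasure M A = (\<integral>\<^sup>+x\<in>A. ennreal (g x) \<partial>lborel) + emeasure M (A \<inter> N)))"
proof -
  txt \<open>A Lebesgue null set of maximal \<open>M\<close>-measure carries the whole singular part.\<close>
  define Q where "Q = {N \<in> sets borel. emeasure lborel (N::real set) = 0}"
  have "Q \<noteq> {}" by (auto simp: Q_def)
  from ennreal_SUP_countable_SUP[OF this, of "emeasure M"]
  obtain v :: "nat \<Rightarrow> ennreal" where v: "range v \<subseteq> emeasure M ` Q" "Sup (emeasure M ` Q) = Sup (range v)"
    by auto
  then have "\<forall>i. \<exists>N. v i = emeasure M N \<and> N \<in> Q" by auto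
  then obtain N' where N': "\<And>i. v i = emeasure M (N' i)" "\<And>i::nat. N' i \<in> Q"
    by metis
  define N where "N = (\<Union>i. N' i)"
  have N_sets[measurable]: "N \<in> sets borel"
    using N'(2) by (auto simp: N_def Q_def)
  have "N \<in> null_sets lborel"
    unfolding N_def using N'(2) by (intro null_sets_UN) (auto simp: Q_def null_sets_def)
  then have N_null: "emeasure lborel N = 0" by auto
  have N_max: "emeasure M A \<le> emeasure M N" if "A \<in> Q" for A
  proof -
    have "emeasure M A \<le> Sup (range v)"
      unfolding v(2)[symmetric] using that by (rule SUP_upper)
    also have "\<dots> \<le> emeasure M N"
      by (rule Sup_least) (use N'(1) in \<open>auto simp: N_def M_is_borel intro!: emeasure_mono N_sets[unfolded N_def]\<close>)
    finally show ?thesis .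
  qed
  define \<nu> where "\<nu> = density M (indicator (- N))"
  have \<nu>: "emeasure \<nu> A = emeasure M (A - N)" if [measurable]: "A \<in> sets borel" for A
  proof -
    have "emeasure \<nu> A = (\<integral>\<^sup>+x. indicator (A - N) x \<partial>M)"
      unfolding \<nu>_def by (subst emeasure_density) (auto simp: indicator_def intro!: nn_integral_cong simp del: nn_integral_indicator)
    then show ?thesis by simp
  qed
  have sets_\<nu>: "sets \<nu> = sets lborel"
    by (simp add: \<nu>_def M_is_borel)
  have "absolutely_continuous lborel \<nu>"
    unfolding absolutely_continuous_def
  proof
    fix A :: "real set" assume "A \<in> null_sets lborel"
    then have A[measurable]: "A \<in> sets borel" and A0: "emeasure lborel A = 0" by auto
    have "N \<union> A \<in> Q"
      using \<open>A \<in> null_sets lborel\<close> \<open>N \<in> null_sets lborel\<close> null_sets.Un[of N lborel A] by (auto simp: Q_def)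
    then have "emeasure M (N \<union> A) \<le> emeasure M N" by (rule N_max)
    moreover have "emeasure M (N \<union> A) = emeasure M N + emeasure M (A - N)"
      by (subst plus_emeasure) (auto simp: M_is_borel)
    ultimately have "emeasure M (A - N) = 0"
      by (simp add: emeasure_eq_measure measure_le_0_iff flip: ennreal_plus)
    then show "A \<in> null_sets \<nu>"
      using \<nu>[OF A] by (auto simp: null_sets_def sets_\<nu>)
  qed
  then obtain f where f[measurable]: "f \<in> borel_measurable lborel" and f_eq: "density lborel f = \<nu>"
    using sigma_finite_measure.Radon_Nikodym[OF sigma_finite_lborel] sets_\<nu> by blast
  have f_int: "(\<integral>\<^sup>+x\<in>A. f x \<partial>lborel) = emeasure M (A - N)" if "A \<in> sets borel" for A
    using \<nu>[OF that] that unfolding f_eq[symmetric] by (subst (asm) emeasure_density) auto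
  have "(\<integral>\<^sup>+x. f x \<partial>lborel) \<noteq> \<infinity>"
    using f_int[of UNIV] by (auto simp: emeasure_eq_measure)
  then have "AE x in lborel. f x \<noteq> \<infinity>"
    by (intro nn_integral_PInf_AE) auto
  then have g_eq: "(\<integral>\<^sup>+x\<in>A. ennreal (enn2real (f x)) \<partial>lborel) = (\<integral>\<^sup>+x\<in>A. f x \<partial>lborel)" for A
    by (intro nn_integral_cong_AE) (auto elim!: eventually_mono simp: less_top)
  show ?thesis
  proof (intro exI[of _ "\<lambda>x. enn2real (f x)"] conjI allI bexI[of _ N] ballI)
    fix A :: "real set" assume A[measurable]: "A \<in> sets borel"
    have "emeasure M A = emeasure M (A - N) + emeasure M (A \<inter> N)"
      by (subst plus_emeasure) (auto simp: M_is_borel intro!: arg_cong[of _ _ "emeasure M"])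
    then show "emeasure M A = (\<integral>\<^sup>+x\<in>A. ennreal (enn2real (f x)) \<partial>lborel) + emeasure M (A \<inter> N)"
      by (simp add: g_eq f_int)
  qed (use N_null in auto)
qed

lemma ac_density_decomposition:
  shows measurable_ac_density: "ac_density M \<in> borel_measurable borel"
    and ac_density_nonneg: "0 \<le> ac_density M x"
    and ex_singular_set: "\<exists>N\<in>sets borel. emeasure lborel N = 0 \<and>
        (\<forall>A\<in>sets borel. emeasure M A = (\<integral>\<^sup>+x\<in>A. ennreal (ac_density M x) \<partial>lborel) + emeasure M (A \<inter> N))"
  using someI_ex[OF ex_lebesgue_decomposition, folded ac_density_def] by auto

lemma integrable_ac_density: "integrable lborel (ac_density M)"
proof (rule integrableI_bounded)
  obtain N where "emeasure M UNIV = (\<integral>\<^sup>+x\<in>UNIV. ennreal (ac_density M x) \<partial>lborel) + emeasure M (UNIV \<inter> N)"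
    using ex_singular_set by (metis sets.top space_borel)
  moreover have "emeasure M UNIV < \<infinity>"
    by (simp add: emeasure_eq_measure)
  ultimately show "(\<integral>\<^sup>+x. ennreal (norm (ac_density M x)) \<partial>lborel) < \<infinity>"
    using ac_density_nonneg by (auto simp: less_top)
qed (simp add: measurable_ac_density)

lemma integral_ac_singular_split:
  obtains N where "N \<in> sets borel" "emeasure lborel N = 0"
    "\<And>f. integrable M f \<Longrightarrow>
      integral\<^sup>L M f = (LINT y|lborel. ac_density M y * f y) + (LINT y|M. indicator N y * f y)"
proof -
  note [measurable] = measurable_ac_density
  obtain N where N[measurable]: "N \<in> sets borel" and N0: "emeasure lborel N = 0"
    and eq: "\<And>A. A \<in> sets borel \<Longrightarrow>
      emeasure M A = (\<integral>\<^sup>+x\<in>A. ennreal (ac_density M x) \<partial>lborel) + emeasure M (A \<inter> N)"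
    using ex_singular_set by blast
  have AE_N: "AE x in lborel. x \<notin> N"
    using N0 N by (intro AE_not_in) (auto simp: null_sets_def)
  have dens: "density M (\<lambda>x. ennreal (indicator (- N) x)) = density lborel (ac_density M)"
  proof (rule measure_eqI)
    fix A assume "A \<in> sets (density M (\<lambda>x. ennreal (indicator (- N) x)))"
    then have A[measurable]: "A \<in> sets borel" by (simp add: M_is_borel)
    have "emeasure (density M (\<lambda>x. ennreal (indicator (- N) x))) A = (\<integral>\<^sup>+x. indicator (A - N) x \<partial>M)"
      by (subst emeasure_density) (auto simp: indicator_def intro!: nn_integral_cong simp del: nn_integral_indicator)
    also have "\<dots> = emeasure M (A - N)" by simp
    also have "\<dots> = (\<integral>\<^sup>+x\<in>A - N. ennreal (ac_density M x) \<partial>lborel)"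
    proof -
      have "(A - N) \<inter> N = {}" by auto
      then show ?thesis using eq[of "A - N"] by simp
    qed
    also have "\<dots> = (\<integral>\<^sup>+x\<in>A. ennreal (ac_density M x) \<partial>lborel)"
      using AE_N by (intro nn_integral_cong_AE) (auto elim!: eventually_mono split: split_indicator)
    also have "\<dots> = emeasure (density lborel (ac_density M)) A"
      by (subst emeasure_density) auto
    finally show "emeasure (density M (\<lambda>x. ennreal (indicator (- N) x))) A
      = emeasure (density lborel (ac_density M)) A" .
  qed (simp add: M_is_borel)
  have "integral\<^sup>L M f = (LINT y|lborel. ac_density M y * f y) + (LINT y|M. indicator N y * f y)"
    if f: "integrable M f" for f
  proof -
    have [measurable]: "f \<in> borel_measurable borel"
      using f M_is_borel by (auto dest: borel_measurable_integrable cong: measurable_cong_sets)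
    have ind: "integrable M (\<lambda>y. indicator S y * f y)" if "S \<in> sets borel" for S
      using integrable_mult_indicator[OF _ f, of S] that by (simp add: M_is_borel)
    have "integral\<^sup>L M f = (LINT y|M. indicator (- N) y * f y + indicator N y * f y)"
      by (intro Bochner_Integration.integral_cong) (auto split: split_indicator)
    also have "\<dots> = (LINT y|M. indicator (- N) y * f y) + (LINT y|M. indicator N y * f y)"
      by (intro Bochner_Integration.integral_add ind) auto
    also have "(LINT y|M. indicator (- N) y * f y) = integral\<^sup>L (density M (\<lambda>x. ennreal (indicator (- N) x))) f"
      by (subst integral_density) auto
    also have "\<dots> = (LINT y|lborel. ac_density M y * f y)"
      unfolding dens by (subst integral_density) (auto simp: ac_density_nonneg)
    finally show ?thesis .
  qed
  with N N0 show ?thesis by (rule that)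
qed

lemma inner_compact:
  assumes N [measurable]: "N \<in> sets borel" and e: "0 < e"
  obtains K where "compact K" "K \<subseteq> N" "measure M (N - K) < e"
proof -
  have reg: "emeasure M N = (SUP K \<in> {K. K \<subseteq> N \<and> compact K}. emeasure M K)"
    using M_is_borel by (intro inner_regular) (auto simp: emeasure_eq_measure)
  have "\<exists>K. compact K \<and> K \<subseteq> N \<and> measure M N - e < measure M K"
  proof (cases "measure M N < e")
    case True
    then show ?thesis by (intro exI[of _ "{}"]) auto
  next
    case False
    have "ennreal (measure M N - e) < ennreal (measure M N)"
      using False e by (intro ennreal_lessI) auto
    then have "ennreal (measure M N - e) < (SUP K \<in> {K. K \<subseteq> N \<and> compact K}. emeasure M K)"
      using reg by (simp add: emeasure_eq_measure)
    then obtain K where "K \<subseteq> N" "compact K" "ennreal (measure M N - e) < emeasure M K"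
      unfolding less_SUP_iff by auto
    then show ?thesis
      using False by (auto simp: emeasure_eq_measure ennreal_less_iff)
  qed
  then obtain K where K: "compact K" "K \<subseteq> N" "measure M N - e < measure M K" by blast
  have "measure M (N - K) = measure M N - measure M K"
    using K compact_imp_closed[OF K(1)] by (intro finite_measure_Diff) (auto simp: M_is_borel)
  with K show ?thesis by (intro that[of K]) auto
qed

end

section \<open>Scaled kernels\<close>

locale scaling_kernel =
  fixes \<psi> :: "real \<Rightarrow> real" and B :: real
  assumes continuous_kernel: "continuous_on UNIV \<psi>"
    and kernel_bound: "\<bar>\<psi> x\<bar> \<le> B"
    and integrable_kernel: "integrable lborel \<psi>"
    and kernel_tail: "((\<lambda>x. x * \<psi> x) \<longlongrightarrow> 0) at_infinity"
begin

lemma measurable_kernel [measurable]: "\<psi> \<in> borel_measurable borel"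
  using continuous_kernel by (rule borel_measurable_continuous_onI)

lemma bound_nonneg: "0 \<le> B"
  using kernel_bound[of 0] by linarith

lemma kernel_tendsto_0: "(\<psi> \<longlongrightarrow> 0) at_infinity"
proof -
  have "((\<lambda>x. inverse x * (x * \<psi> x)) \<longlongrightarrow> 0 * 0) at_infinity"
    by (intro tendsto_mult tendsto_inverse_0 kernel_tail)
  moreover have "\<forall>\<^sub>F x in at_infinity. inverse x * (x * \<psi> x) = \<psi> x"
    using eventually_not_equal_at_infinity[of "0::real"] by eventually_elim auto
  ultimately show ?thesis
    by (auto elim: Lim_transform_eventually)
qed

lemma kernel_concentrates:
  assumes "z \<noteq> y"
  shows "((\<lambda>a. \<psi> (u + (y - z) / a)) \<longlongrightarrow> 0) (at_right 0)"
proof (rule filterlim_compose[OF kernel_tendsto_0])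
  have "filterlim (\<lambda>a. (y - z) / a) at_infinity (at_right 0)"
    using assms by (intro filterlim_divide_at_infinity[where c = "y - z"] tendsto_const)
      (simp_all add: filterlim_at eventually_at_topological, blast)
  then show "filterlim (\<lambda>a. u + (y - z) / a) at_infinity (at_right 0)"
    by (intro tendsto_add_filterlim_at_infinity[OF tendsto_const])
qed

lemma integrable_kernel_square: "integrable lborel (\<lambda>x. (\<psi> x)\<^sup>2)"
proof (rule Bochner_Integration.integrable_bound[of _ "\<lambda>x. B * \<psi> x"])
  show "AE x in lborel. norm ((\<psi> x)\<^sup>2) \<le> norm (B * \<psi> x)"
  proof (rule AE_I2)
    fix x
    have "\<bar>\<psi> x\<bar> * \<bar>\<psi> x\<bar> \<le> B * \<bar>\<psi> x\<bar>"
      by (intro mult_right_mono kernel_bound) simp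
    then show "norm ((\<psi> x)\<^sup>2) \<le> norm (B * \<psi> x)"
      using bound_nonneg by (simp add: power2_eq_square abs_mult)
  qed
qed (simp_all add: integrable_kernel)

definition mollify :: "real \<Rightarrow> real measure \<Rightarrow> (real \<Rightarrow> real) \<Rightarrow> real \<Rightarrow> real" where
  "mollify a \<nu> h x = (LINT y|\<nu>. h y * ((1 / a) * \<psi> ((x - y) / a)))"

lemma measurable_mollify:
  assumes "sigma_finite_measure \<nu>" and [measurable_cong]: "sets \<nu> = sets borel"
    and [measurable]: "h \<in> borel_measurable borel"
  shows "mollify a \<nu> h \<in> borel_measurable borel"
proof -
  interpret sigma_finite_measure \<nu> by fact
  show ?thesis
    unfolding mollify_def by measurable
qed

lemma nn_integral_kernel: "(\<integral>\<^sup>+u. ennreal \<bar>\<psi> u\<bar> \<partial>lborel) = ennreal (LINT u|lborel. \<bar>\<psi> u\<bar>)"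
  by (intro nn_integral_eq_integral integrable_abs integrable_kernel) auto

lemma nn_integral_mollify_le:
  assumes "sigma_finite_measure \<nu>" and [measurable_cong]: "sets \<nu> = sets borel"
    and [measurable]: "h \<in> borel_measurable borel" and a: "0 < a"
  shows "(\<integral>\<^sup>+x. ennreal \<bar>mollify a \<nu> h x\<bar> \<partial>lborel)
    \<le> (\<integral>\<^sup>+y. ennreal \<bar>h y\<bar> \<partial>\<nu>) * ennreal (LINT u|lborel. \<bar>\<psi> u\<bar>)"
proof -
  interpret sigma_finite_measure \<nu> by fact
  interpret P: pair_sigma_finite \<nu> lborel ..
  define k where "k y x = ennreal (\<bar>h y\<bar> * ((1 / a) * \<bar>\<psi> ((x - y) / a)\<bar>))" for y x
  have "ennreal \<bar>mollify a \<nu> h x\<bar> \<le> (\<integral>\<^sup>+y. k y x \<partial>\<nu>)" for x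
  proof (cases "integrable \<nu> (\<lambda>y. h y * ((1 / a) * \<psi> ((x - y) / a)))")
    case True
    show ?thesis
      unfolding mollify_def k_def
      using integral_norm_bound_ennreal[OF True] a by (simp add: abs_mult)
  next
    case False
    then have "mollify a \<nu> h x = 0"
      unfolding mollify_def by (rule not_integrable_integral_eq)
    then show ?thesis by simp
  qed
  then have "(\<integral>\<^sup>+x. ennreal \<bar>mollify a \<nu> h x\<bar> \<partial>lborel) \<le> (\<integral>\<^sup>+x. \<integral>\<^sup>+y. k y x \<partial>\<nu> \<partial>lborel)"
    by (intro nn_integral_mono) auto
  also have "\<dots> = (\<integral>\<^sup>+y. \<integral>\<^sup>+x. k y x \<partial>lborel \<partial>\<nu>)"
    unfolding k_def by (rule P.Fubini') measurable
  also have "\<dots> = (\<integral>\<^sup>+y. ennreal \<bar>h y\<bar> * ennreal (LINT u|lborel. \<bar>\<psi> u\<bar>) \<partial>\<nu>)"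
  proof (rule nn_integral_cong)
    fix y
    have "(\<integral>\<^sup>+x. k y x \<partial>lborel) = ennreal \<bar>a\<bar> * (\<integral>\<^sup>+u. k y (y + a * u) \<partial>lborel)"
      by (rule nn_integral_real_affine) (use a in \<open>auto simp: k_def\<close>)
    also have "\<dots> = (\<integral>\<^sup>+u. ennreal \<bar>a\<bar> * k y (y + a * u) \<partial>lborel)"
      by (rule nn_integral_cmult[symmetric]) (simp add: k_def)
    also have "\<dots> = (\<integral>\<^sup>+u. ennreal \<bar>h y\<bar> * ennreal \<bar>\<psi> u\<bar> \<partial>lborel)"
      using a by (intro nn_integral_cong) (simp add: k_def flip: ennreal_mult)
    also have "\<dots> = ennreal \<bar>h y\<bar> * ennreal (LINT u|lborel. \<bar>\<psi> u\<bar>)"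
      by (simp add: nn_integral_cmult nn_integral_kernel)
    finally show "(\<integral>\<^sup>+x. k y x \<partial>lborel) = ennreal \<bar>h y\<bar> * ennreal (LINT u|lborel. \<bar>\<psi> u\<bar>)" .
  qed
  also have "\<dots> = (\<integral>\<^sup>+y. ennreal \<bar>h y\<bar> \<partial>\<nu>) * ennreal (LINT u|lborel. \<bar>\<psi> u\<bar>)"
    by (rule nn_integral_multc) auto
  finally show ?thesis .
qed

lemma mollify_continuous_tendsto:
  assumes cont: "continuous_on UNIV \<phi>" and bnd: "\<And>x. \<bar>\<phi> x\<bar> \<le> C"
    and I [measurable]: "I \<in> sets borel" and I_fin: "emeasure lborel I < \<infinity>" and e: "0 < (e::real)"
  shows "\<forall>\<^sub>F a in at_right 0.
    (\<integral>\<^sup>+x. ennreal (\<bar>mollify a lborel \<phi> x - (LINT u|lborel. \<psi> u) * \<phi> x\<bar> * indicator I x) \<partial>lborel) \<le> ennreal e"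
proof -
  define A where "A = (LINT u|lborel. \<psi> u)"
  define L where "L = (LINT u|lborel. C * \<bar>\<psi> u\<bar>)"
  have [measurable]: "\<phi> \<in> borel_measurable borel"
    using cont by (rule borel_measurable_continuous_onI)
  have mm [measurable]: "mollify a lborel \<phi> \<in> borel_measurable borel" for a
    by (rule measurable_mollify) (auto intro: sigma_finite_lborel)
  have int_C: "integrable lborel (\<lambda>u. C * \<bar>\<psi> u\<bar>)"
    by (auto intro: integrable_kernel)
  have le_C: "norm (\<phi> (x - a * u) * \<psi> u) \<le> C * \<bar>\<psi> u\<bar>" for x a u
    by (auto simp: abs_mult intro!: mult_right_mono bnd)
  have eq: "mollify a lborel \<phi> x = (LINT u|lborel. \<phi> (x - a * u) * \<psi> u)" if "a > 0" for a x
    unfolding mollify_def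
    using that by (subst lborel_integral_real_affine[of "- a" _ x]) auto
  have lim: "((\<lambda>a. mollify a lborel \<phi> x) \<longlongrightarrow> A * \<phi> x) (at_right 0)" for x
  proof -
    have "((\<lambda>a. LINT u|lborel. \<phi> (x - a * u) * \<psi> u) \<longlongrightarrow> (LINT u|lborel. \<phi> x * \<psi> u)) (at_right 0)"
    proof (rule integral_dominated_convergence_at_right[where w = "\<lambda>u. C * \<bar>\<psi> u\<bar>"])
      show "AE u in lborel. ((\<lambda>a. \<phi> (x - a * u) * \<psi> u) \<longlongrightarrow> \<phi> x * \<psi> u) (at_right 0)"
      proof (intro AE_I2 tendsto_mult tendsto_const)
        fix u
        have "((\<lambda>a. x - a * u) \<longlongrightarrow> x - 0 * u) (at_right 0)"
          by (intro tendsto_intros)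
        then have "((\<lambda>a. x - a * u) \<longlongrightarrow> x) (at_right 0)" by simp
        moreover have "isCont \<phi> x"
          using cont by (simp add: continuous_on_eq_continuous_at)
        ultimately show "((\<lambda>a. \<phi> (x - a * u)) \<longlongrightarrow> \<phi> x) (at_right 0)"
          by (rule isCont_tendsto_compose[rotated])
      qed
    qed (use int_C le_C in auto)
    moreover have "\<forall>\<^sub>F a in at_right 0. (LINT u|lborel. \<phi> (x - a * u) * \<psi> u) = mollify a lborel \<phi> x"
      using eventually_at_right_less[of 0] by eventually_elim (simp add: eq)
    ultimately have "((\<lambda>a. mollify a lborel \<phi> x) \<longlongrightarrow> (LINT u|lborel. \<phi> x * \<psi> u)) (at_right 0)"
      by (rule Lim_transform_eventually)
    then show ?thesis by (simp add: A_def mult.commute)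
  qed
  have L: "\<bar>mollify a lborel \<phi> x\<bar> \<le> L" if "a > 0" for a x
  proof -
    have "norm (mollify a lborel \<phi> x) \<le> L"
      unfolding eq[OF that] L_def
    proof (rule Bochner_Integration.integral_norm_bound_integral[OF _ int_C le_C])
      show "integrable lborel (\<lambda>u. \<phi> (x - a * u) * \<psi> u)"
        by (rule Bochner_Integration.integrable_bound[OF int_C]) (use order.trans[OF le_C abs_ge_self] in auto)
    qed
    then show ?thesis by simp
  qed
  define H where "H a x = \<bar>mollify a lborel \<phi> x - A * \<phi> x\<bar> * indicator I x" for a x
  have H_bound: "\<bar>H a x\<bar> \<le> (L + \<bar>A\<bar> * C) * indicator I x" if "a > 0" for a x
  proof -
    have "\<bar>mollify a lborel \<phi> x - A * \<phi> x\<bar> \<le> L + \<bar>A\<bar> * C"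
      using L[OF that, of x] mult_left_mono[OF bnd[of x] abs_ge_zero[of A]]
        abs_triangle_ineq4[of "mollify a lborel \<phi> x" "A * \<phi> x"] by (simp add: abs_mult)
    then show ?thesis by (auto simp: H_def split: split_indicator)
  qed
  have H_meas [measurable]: "H a \<in> borel_measurable borel" for a
    unfolding H_def by measurable
  have int_I: "integrable lborel (\<lambda>x. (L + \<bar>A\<bar> * C) * indicator I x)"
    using I_fin by (auto intro!: integrable_real_indicator)
  have "((\<lambda>a. LINT x|lborel. H a x) \<longlongrightarrow> (LINT x|(lborel :: real measure). 0)) (at_right 0)"
  proof (rule integral_dominated_convergence_at_right[where w = "\<lambda>x. (L + \<bar>A\<bar> * C) * indicator I x"])
    show "AE x in lborel. ((\<lambda>a. H a x) \<longlongrightarrow> 0) (at_right 0)"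
    proof (rule AE_I2)
      fix x
      have "((\<lambda>a. H a x) \<longlongrightarrow> \<bar>A * \<phi> x - A * \<phi> x\<bar> * indicator I x) (at_right 0)"
        unfolding H_def by (intro tendsto_intros lim)
      then show "((\<lambda>a. H a x) \<longlongrightarrow> 0) (at_right 0)" by simp
    qed
  qed (use int_I H_bound in auto)
  then have "\<forall>\<^sub>F a in at_right 0. (LINT x|lborel. H a x) < e"
    using e by (intro order_tendstoD(2)) auto
  then show ?thesis
    using eventually_at_right_less[of 0]
  proof eventually_elim
    case (elim a)
    have "integrable lborel (H a)"
      by (rule Bochner_Integration.integrable_bound[OF int_I])
        (use order.trans[OF H_bound[OF elim(2)] abs_ge_self] in auto)
    then have "(\<integral>\<^sup>+x. ennreal (H a x) \<partial>lborel) = ennreal (LINT x|lborel. H a x)"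
      by (rule nn_integral_eq_integral) (auto simp: H_def)
    then show ?case
      using elim(1) by (simp add: H_def A_def ennreal_leI)
  qed
qed

end

section \<open>Convolution of a kernel with a finite measure\<close>

locale kernel_convolution = scaling_kernel \<psi> B + finite_borel_measure M
  for \<psi> B M
begin

abbreviation scaled_conv :: "real \<Rightarrow> real \<Rightarrow> real" where
  "scaled_conv a \<equiv> conv_meas (\<lambda>t. \<psi> (t / a)) M"

lemma measurable_conv_meas [measurable]:
  assumes [measurable]: "f \<in> borel_measurable borel"
  shows "conv_meas f M \<in> borel_measurable borel"
  unfolding conv_meas_def by measurable

lemma integrable_scaled_kernel: "integrable M (\<lambda>y. \<psi> ((x - y) / a))"
  by (rule integrable_const_bound[where B = B]) (auto simp: kernel_bound)

lemma scaled_conv_bound: "\<bar>scaled_conv a x\<bar> \<le> B * measure M UNIV"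
proof -
  have "norm (scaled_conv a x) \<le> (LINT y|M. B)"
    unfolding conv_meas_def
    by (rule Bochner_Integration.integral_norm_bound_integral[OF integrable_scaled_kernel]) (auto simp: kernel_bound)
  then show ?thesis by (simp add: mult.commute)
qed

lemma scaled_conv_tendsto_atom:
  "((\<lambda>a. scaled_conv a (y + a * u)) \<longlongrightarrow> \<psi> u * measure M {y}) (at_right 0)"
proof -
  have "((\<lambda>a. LINT z|M. \<psi> ((y + a * u - z) / a)) \<longlongrightarrow> (LINT z|M. \<psi> u * indicator {y} z)) (at_right 0)"
  proof (rule integral_dominated_convergence_at_right[where w = "\<lambda>_. B"])
    show "AE z in M. ((\<lambda>a. \<psi> ((y + a * u - z) / a)) \<longlongrightarrow> \<psi> u * indicator {y} z) (at_right 0)"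
    proof (rule AE_I2)
      fix z
      have "((\<lambda>a. \<psi> (u + (y - z) / a)) \<longlongrightarrow> \<psi> u * indicator {y} z) (at_right 0)"
        by (cases "z = y") (auto simp: kernel_concentrates)
      moreover have "\<forall>\<^sub>F a in at_right 0. \<psi> (u + (y - z) / a) = \<psi> ((y + a * u - z) / a)"
        using eventually_at_right_less[of "0::real"]
        by eventually_elim (simp add: field_simps)
      ultimately show "((\<lambda>a. \<psi> ((y + a * u - z) / a)) \<longlongrightarrow> \<psi> u * indicator {y} z) (at_right 0)"
        by (rule Lim_transform_eventually)
    qed
  qed (auto simp: kernel_bound)
  then show ?thesis
    by (simp add: conv_meas_def)
qed

lemma scaled_conv_square_integral:
  assumes a: "a > 0"
  shows "(1 / a) * (LBINT x:{c<..<d}. (scaled_conv a x)\<^sup>2)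
    = (LINT y|M. LINT u|lborel. indicator {c<..<d} (y + a * u) * scaled_conv a (y + a * u) * \<psi> u)"
proof -
  interpret P: pair_sigma_finite M lborel ..
  define F where "F y x = indicator {c<..<d} x * scaled_conv a x * \<psi> ((x - y) / a)" for y x
  have "integrable (M \<Otimes>\<^sub>M lborel) (case_prod F)"
  proof (rule integrableI_bounded_set[where A = "UNIV \<times> {c<..<d}" and B = "B * measure M UNIV * B"])
    show "UNIV \<times> {c<..<d} \<in> sets (M \<Otimes>\<^sub>M lborel)"
      by (intro pair_measureI) (auto simp: M_is_borel)
    show "case_prod F \<in> borel_measurable (M \<Otimes>\<^sub>M lborel)"
      unfolding F_def by measurable
    show "emeasure (M \<Otimes>\<^sub>M lborel) (UNIV \<times> {c<..<d}) < \<infinity>"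
    proof -
      have "emeasure (M \<Otimes>\<^sub>M lborel) (UNIV \<times> {c<..<d}) = emeasure M UNIV * emeasure lborel {c<..<d}"
        by (rule lborel.emeasure_pair_measure_Times) (auto simp: M_is_borel)
      then show ?thesis
        by (cases "c \<le> d") (auto simp: emeasure_eq_measure ennreal_mult_less_top)
    qed
    show "AE x in M \<Otimes>\<^sub>M lborel. x \<in> UNIV \<times> {c<..<d} \<longrightarrow> norm (case_prod F x) \<le> B * measure M UNIV * B"
      by (intro AE_I2) (auto simp: F_def abs_mult intro!: mult_mono scaled_conv_bound kernel_bound
        mult_nonneg_nonneg bound_nonneg)
  qed (auto simp: F_def indicator_def intro!: AE_I2)
  note Fubini = P.Fubini_integral[OF this]
  have "(LBINT x:{c<..<d}. (scaled_conv a x)\<^sup>2) = (LINT x|lborel. LINT y|M. F y x)"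
    unfolding set_lebesgue_integral_def F_def
    by (intro Bochner_Integration.integral_cong) (auto simp: conv_meas_def power2_eq_square)
  also have "\<dots> = (LINT y|M. LINT x|lborel. F y x)"
    by (rule Fubini)
  also have "\<dots> = (LINT y|M. a * (LINT u|lborel. F y (y + a * u)))"
    using a by (intro Bochner_Integration.integral_cong refl) (subst lborel_integral_real_affine[of a], auto)
  finally show ?thesis
    using a by (simp add: F_def)
qed

theorem scaled_conv_square_tendsto:
  assumes even: "\<And>x. \<psi> (- x) = \<psi> x" and cd: "c < d"
  shows "((\<lambda>a. (1 / a) * (LBINT x:{c<..<d}. (scaled_conv a x)\<^sup>2))
    \<longlongrightarrow> (LINT x|lborel. (\<psi> x)\<^sup>2) * ((\<Sum>\<^sub>\<infinity>x\<in>{c<..<d}. (measure M {x})\<^sup>2)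
          + 1/2 * ((measure M {c})\<^sup>2 + (measure M {d})\<^sup>2))) (at_right 0)"
proof -
  define I where "I = {c<..<d}"
  define C where "C = (LINT x|lborel. (\<psi> x)\<^sup>2)"
  define G where "G a y = (LINT u|lborel. indicator I (y + a * u) * scaled_conv a (y + a * u) * \<psi> u)" for a y
  define W :: "real \<Rightarrow> real" where "W y = indicator I y + 1/2 * indicator {c} y + 1/2 * indicator {d} y" for y
  define J where "J y = (if y \<in> I then UNIV else if y = c then {0<..} else if y = d then {..<0} else {} :: real set)" for y
  have J[measurable]: "J y \<in> sets borel" for y
    by (simp add: J_def)
  have I[measurable]: "I \<in> sets borel"
    by (simp add: I_def)
  have half: "(LINT u|lborel. indicator {0<..} u * (\<psi> u)\<^sup>2) = C / 2"
    "(LINT u|lborel. indicator {..<0} u * (\<psi> u)\<^sup>2) = C / 2"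
  proof -
    have eq: "(LINT u|lborel. indicator {0<..} u * (\<psi> u)\<^sup>2) = (LINT u|lborel. indicator {..<0} u * (\<psi> u)\<^sup>2)"
      by (subst lborel_integral_real_affine[of "-1" _ 0])
        (auto simp: even intro!: Bochner_Integration.integral_cong split: split_indicator)
    have int: "integrable lborel (\<lambda>u. indicator A u * (\<psi> u)\<^sup>2)" if "A \<in> sets borel" for A
      using integrable_mult_indicator[OF _ integrable_kernel_square, of A] that by simp
    have "C = (LINT u|lborel. indicator {0<..} u * (\<psi> u)\<^sup>2 + indicator {..<0} u * (\<psi> u)\<^sup>2)"
      unfolding C_def
      by (intro integral_cong_AE) (use AE_lborel_singleton[of 0] in \<open>auto split: split_indicator elim!: eventually_mono\<close>)
    also have "\<dots> = (LINT u|lborel. indicator {0<..} u * (\<psi> u)\<^sup>2) + (LINT u|lborel. indicator {..<0} u * (\<psi> u)\<^sup>2)"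
      by (intro Bochner_Integration.integral_add int) auto
    finally show "(LINT u|lborel. indicator {0<..} u * (\<psi> u)\<^sup>2) = C / 2"
      "(LINT u|lborel. indicator {..<0} u * (\<psi> u)\<^sup>2) = C / 2"
      using eq by auto
  qed
  have ind_lim: "((\<lambda>a. indicator I (y + a * u)) \<longlongrightarrow> (indicator (J y) u :: real)) (at_right 0)" if u: "u \<noteq> 0" for y u
  proof (rule tendsto_eventually)
    have line: "((\<lambda>a. y + a * u) \<longlongrightarrow> y + 0 * u) (at_right 0)"
      by (intro tendsto_intros)
    consider "y < c" | "d < y" | "c < y" "y < d" | "y = c" | "y = d" by linarith
    then show "\<forall>\<^sub>F a in at_right 0. (indicator I (y + a * u) :: real) = indicator (J y) u"
    proof cases
      case 1
      then have "\<forall>\<^sub>F a in at_right 0. y + a * u < c"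
        using order_tendstoD(2)[OF line, of c] by simp
      then show ?thesis
        by eventually_elim (use 1 cd in \<open>auto simp: J_def I_def\<close>)
    next
      case 2
      then have "\<forall>\<^sub>F a in at_right 0. y + a * u > d"
        using order_tendstoD(1)[OF line, of d] by simp
      then show ?thesis
        by eventually_elim (use 2 cd in \<open>auto simp: J_def I_def\<close>)
    next
      case 3
      then have "\<forall>\<^sub>F a in at_right 0. y + a * u > c" "\<forall>\<^sub>F a in at_right 0. y + a * u < d"
        using order_tendstoD(1)[OF line, of c] order_tendstoD(2)[OF line, of d] by simp_all
      then show ?thesis
        by eventually_elim (use 3 in \<open>auto simp: J_def I_def\<close>)
    next
      case 4
      then have "\<forall>\<^sub>F a in at_right 0. y + a * u < d"
        using order_tendstoD(2)[OF line, of d] cd by simp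
      then show ?thesis
        using eventually_at_right_less[of 0]
        by eventually_elim (use 4 cd u in \<open>auto simp: J_def I_def zero_less_mult_iff split: split_indicator\<close>)
    next
      case 5
      then have "\<forall>\<^sub>F a in at_right 0. y + a * u > c"
        using order_tendstoD(1)[OF line, of c] cd by simp
      then show ?thesis
        using eventually_at_right_less[of 0]
        by eventually_elim (use 5 cd u in \<open>auto simp: J_def I_def mult_less_0_iff split: split_indicator\<close>)
    qed
  qed
  have G_lim: "((\<lambda>a. G a y) \<longlongrightarrow> C * (W y * measure M {y})) (at_right 0)" for y
  proof -
    have "((\<lambda>a. G a y) \<longlongrightarrow> (LINT u|lborel. indicator (J y) u * (\<psi> u * measure M {y}) * \<psi> u)) (at_right 0)"
      unfolding G_def
    proof (rule integral_dominated_convergence_at_right[where w = "\<lambda>u. B * measure M UNIV * \<bar>\<psi> u\<bar>"])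
      show "AE u in lborel. ((\<lambda>a. indicator I (y + a * u) * scaled_conv a (y + a * u) * \<psi> u)
          \<longlongrightarrow> indicator (J y) u * (\<psi> u * measure M {y}) * \<psi> u) (at_right 0)"
        using AE_lborel_singleton[of 0]
        by eventually_elim (intro tendsto_mult tendsto_const ind_lim scaled_conv_tendsto_atom)
      show "AE u in lborel. norm (indicator I (y + a * u) * scaled_conv a (y + a * u) * \<psi> u)
          \<le> B * measure M UNIV * \<bar>\<psi> u\<bar>" for a
        by (auto simp: abs_mult bound_nonneg split: split_indicator intro!: mult_right_mono scaled_conv_bound)
    qed (auto intro!: integrable_kernel)
    also have "(LINT u|lborel. indicator (J y) u * (\<psi> u * measure M {y}) * \<psi> u)
        = measure M {y} * (LINT u|lborel. indicator (J y) u * (\<psi> u)\<^sup>2)"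
      unfolding integral_mult_right_zero[symmetric]
      by (intro Bochner_Integration.integral_cong) (auto simp: power2_eq_square)
    also have "(LINT u|lborel. indicator (J y) u * (\<psi> u)\<^sup>2) = C * W y"
      using cd half by (auto simp: J_def W_def I_def C_def split: split_indicator)
    finally show ?thesis by (simp add: mult_ac)
  qed
  have G_bound: "\<bar>G a y\<bar> \<le> (LINT u|lborel. B * measure M UNIV * \<bar>\<psi> u\<bar>)" for a y
  proof -
    have le: "norm (indicator I (y + a * u) * scaled_conv a (y + a * u) * \<psi> u)
        \<le> B * measure M UNIV * \<bar>\<psi> u\<bar>" for u
      by (auto simp: abs_mult bound_nonneg split: split_indicator intro!: mult_right_mono scaled_conv_bound)
    have int: "integrable lborel (\<lambda>u. B * measure M UNIV * \<bar>\<psi> u\<bar>)"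
      by (auto intro: integrable_kernel)
    have "norm (G a y) \<le> (LINT u|lborel. B * measure M UNIV * \<bar>\<psi> u\<bar>)"
      unfolding G_def
    proof (rule Bochner_Integration.integral_norm_bound_integral[OF _ int le])
      show "integrable lborel (\<lambda>u. indicator I (y + a * u) * scaled_conv a (y + a * u) * \<psi> u)"
        by (rule Bochner_Integration.integrable_bound[OF int])
          (use order.trans[OF le abs_ge_self] in auto)
    qed
    then show ?thesis by simp
  qed
  have "((\<lambda>a. LINT y|M. G a y) \<longlongrightarrow> (LINT y|M. C * (W y * measure M {y}))) (at_right 0)"
  proof (rule integral_dominated_convergence_at_right[where w = "\<lambda>_. LINT u|lborel. B * measure M UNIV * \<bar>\<psi> u\<bar>"])
    show "(\<lambda>y. G a y) \<in> borel_measurable M" for a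
      unfolding G_def by measurable
    show "(\<lambda>y. C * (W y * measure M {y})) \<in> borel_measurable M"
      unfolding W_def by measurable
  qed (use G_lim G_bound in auto)
  also have "(LINT y|M. C * (W y * measure M {y})) = C * (LINT y|M. W y * measure M {y})"
    by simp
  also have "(LINT y|M. W y * measure M {y}) = (\<Sum>\<^sub>\<infinity>x\<in>I. (measure M {x})\<^sup>2)
          + 1/2 * ((measure M {c})\<^sup>2 + (measure M {d})\<^sup>2)"
  proof -
    have int: "integrable M (\<lambda>y. indicator S y * measure M {y})" if "S \<in> sets borel" for S
      using that by (intro integrable_const_bound[where B = "measure M UNIV"])
        (auto simp: bounded_measure[simplified] split: split_indicator)
    have "(LINT y|M. W y * measure M {y}) = (LINT y|M. indicator I y * measure M {y}
        + (1/2 * (indicator {c} y * measure M {y}) + 1/2 * (indicator {d} y * measure M {y})))"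
      by (intro Bochner_Integration.integral_cong) (auto simp: W_def algebra_simps)
    also have "\<dots> = (LINT y|M. indicator I y * measure M {y})
        + (1/2 * (LINT y|M. indicator {c} y * measure M {y}) + 1/2 * (LINT y|M. indicator {d} y * measure M {y}))"
      using int[of I] int[of "{c}"] int[of "{d}"] by simp
    finally show ?thesis
      by (subst (asm) (1 2 3) integral_atom_mass) (auto simp: algebra_simps)
  qed
  finally have lim: "((\<lambda>a. LINT y|M. G a y) \<longlongrightarrow> C * ((\<Sum>\<^sub>\<infinity>x\<in>I. (measure M {x})\<^sup>2)
          + 1/2 * ((measure M {c})\<^sup>2 + (measure M {d})\<^sup>2))) (at_right 0)" .
  have "\<forall>\<^sub>F a in at_right 0. (LINT y|M. G a y) = (1 / a) * (LBINT x:{c<..<d}. (scaled_conv a x)\<^sup>2)"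
    using eventually_at_right_less[of 0]
    by eventually_elim (simp only: scaled_conv_square_integral G_def I_def)
  with lim show ?thesis
    unfolding C_def I_def by (rule Lim_transform_eventually)
qed

lemma conv_meas_eq_mollify: "conv_meas (\<lambda>t. (1 / a) * \<psi> (t / a)) M = mollify a M (\<lambda>_. 1)"
  by (simp add: fun_eq_iff conv_meas_def mollify_def)

lemma integrable_mollifier: "integrable M (\<lambda>y. (1 / a) * \<psi> ((x - y) / a))"
  using integrable_scaled_kernel by (rule integrable_mult_right)

lemma mollify_compact_small:
  assumes K: "compact K" and U: "open U" "K \<subseteq> U" and e: "0 < e"
  shows "\<forall>\<^sub>F a in at_right 0. \<forall>x\<in>- U. \<bar>mollify a M (indicator K) x\<bar> \<le> e * measure M UNIV"
proof -
  obtain d where d: "0 < d" "\<And>y x. y \<in> K \<Longrightarrow> x \<in> - U \<Longrightarrow> d \<le> dist y x"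
    using separate_compact_closed[OF K, of "- U"] U by (metis closed_Compl disjoint_eq_subset_Compl double_complement)
  have "\<forall>\<^sub>F v in at_infinity. \<bar>v * \<psi> v\<bar> < e * d"
    using order_tendstoD(2)[OF tendsto_rabs[OF kernel_tail], of "e * d"] d(1) e by simp
  then obtain R where R: "\<And>v. R \<le> \<bar>v\<bar> \<Longrightarrow> \<bar>v * \<psi> v\<bar> < e * d"
    by (auto simp: eventually_at_infinity)
  have "\<forall>\<^sub>F a in at_right 0. a < d / (\<bar>R\<bar> + 1)"
    using d(1) by (intro eventually_at_right_field[THEN iffD2] exI[of _ "d / (\<bar>R\<bar> + 1)"]) auto
  then show ?thesis
    using eventually_at_right_less[of 0]
  proof eventually_elim
    case (elim a)
    show ?case
    proof
      fix x assume x: "x \<in> - U"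
      have pt: "norm (indicator K y * ((1 / a) * \<psi> ((x - y) / a))) \<le> e" for y
      proof (cases "y \<in> K")
        case True
        have far: "d \<le> \<bar>x - y\<bar>"
          using d(2)[OF True x] by (simp add: dist_real_def abs_minus_commute)
        have "a * R \<le> a * (\<bar>R\<bar> + 1)"
          using elim(2) by (intro mult_left_mono) auto
        also have "\<dots> \<le> \<bar>x - y\<bar>"
          using elim(1) far by (simp add: field_simps)
        finally have "R \<le> \<bar>(x - y) / a\<bar>"
          using elim(2) by (simp add: field_simps)
        then have "\<bar>(x - y) / a * \<psi> ((x - y) / a)\<bar> \<le> e * \<bar>x - y\<bar>"
          using R[of "(x - y) / a"] mult_left_mono[OF far, of e] e by linarith
        then have "\<bar>x - y\<bar> * ((1 / a) * \<bar>\<psi> ((x - y) / a)\<bar>) \<le> \<bar>x - y\<bar> * e"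
          using elim(2) by (simp add: abs_mult mult_ac)
        then have "(1 / a) * \<bar>\<psi> ((x - y) / a)\<bar> \<le> e"
          by (rule mult_left_le_imp_le) (use far d(1) in linarith)
        then show ?thesis
          using True elim(2) by (simp add: abs_mult)
      qed (use e in auto)
      have "norm (mollify a M (indicator K) x) \<le> (LINT y|M. e)"
        unfolding mollify_def
      proof (rule Bochner_Integration.integral_norm_bound_integral[OF _ _ pt])
        show "integrable M (\<lambda>y. indicator K y * ((1 / a) * \<psi> ((x - y) / a)))"
          using integrable_mult_indicator[OF _ integrable_mollifier, of K a x] compact_imp_closed[OF K] by (simp add: M_is_borel)
      qed auto
      then show "\<bar>mollify a M (indicator K) x\<bar> \<le> e * measure M UNIV"
        by (simp add: mult.commute)
    qed
  qed
qed

lemma mollify_L1_off_small_set: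
  assumes I [measurable]: "I \<in> sets borel" and I_fin: "emeasure lborel I < \<infinity>" and e: "0 < (e::real)"
  shows "\<exists>U\<in>sets lborel. emeasure lborel U \<le> ennreal e \<and>
    (\<forall>\<^sub>F a in at_right 0. (\<integral>\<^sup>+x. ennreal (\<bar>mollify a M (\<lambda>_. 1) x - (LINT u|lborel. \<psi> u) * ac_density M x\<bar>
      * indicator (I - U) x) \<partial>lborel) \<le> ennreal e)"
proof -
  note [measurable] = measurable_ac_density
  define g where "g = ac_density M"
  have [measurable]: "g \<in> borel_measurable borel" by (simp add: g_def)
  have int_g: "integrable lborel g" by (simp add: g_def integrable_ac_density)
  define A where "A = (LINT u|lborel. \<psi> u)"
  define L where "L = (LINT u|lborel. \<bar>\<psi> u\<bar>)"
  have L: "0 \<le> L" "\<bar>A\<bar> \<le> L"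
    unfolding A_def L_def using integral_norm_bound[of lborel \<psi>] by auto
  define \<eta> where "\<eta> = e / (8 * (L + 1))"
  have \<eta>: "0 < \<eta>" "L * \<eta> \<le> e / 8"
    using L e by (auto simp: \<eta>_def field_simps)
  define m where "m = measure lborel I"
  have m: "0 \<le> m" "emeasure lborel I = ennreal m"
    using I_fin by (auto simp: m_def emeasure_eq_ennreal_measure)
  define t where "t = e / (4 * ((m + 1) * (measure M UNIV + 1)))"
  have t: "0 < t" "t * measure M UNIV * m \<le> e / 4"
  proof -
    have pos: "0 < (m + 1) * (measure M UNIV + 1)"
      using m by (intro mult_pos_pos) (auto intro: add_nonneg_pos)
    then show "0 < t"
      unfolding t_def using e pos by (metis divide_pos_pos mult_pos_pos zero_less_numeral)
    have "measure M UNIV * m \<le> (m + 1) * (measure M UNIV + 1)"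
      using m by (simp add: algebra_simps)
    then have "t * (measure M UNIV * m) \<le> t * ((m + 1) * (measure M UNIV + 1))"
      using \<open>0 < t\<close> by (intro mult_left_mono) auto
    also have "\<dots> = e / 4"
      using pos by (simp add: t_def field_simps)
    finally show "t * measure M UNIV * m \<le> e / 4" by (simp add: mult_ac)
  qed
  obtain N where N[measurable]: "N \<in> sets borel" and N0: "emeasure lborel N = 0"
    and split: "\<And>f. integrable M f \<Longrightarrow>
      integral\<^sup>L M f = (LINT y|lborel. g y * f y) + (LINT y|M. indicator N y * f y)"
    using integral_ac_singular_split unfolding g_def by metis
  obtain K where K: "compact K" "K \<subseteq> N" "measure M (N - K) < \<eta>"
    using inner_compact[OF N \<eta>(1)] by blast
  have K_sets [measurable]: "K \<in> sets borel"
    using compact_imp_closed[OF K(1)] by simp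
  obtain U where U: "open U" "K \<subseteq> U" "emeasure lborel (U - K) < ennreal e"
    using outer_regular_lborel[OF K_sets e] by blast
  have U_sets [measurable]: "U \<in> sets borel" using U by simp
  have "emeasure lborel K = 0"
    using emeasure_mono[OF K(2), of lborel] N0 by simp
  then have U_small: "emeasure lborel U \<le> ennreal e"
    using emeasure_subadditive[of "U - K" lborel K] U by (simp add: Un_absorb2)
  obtain \<phi> C where \<phi>: "continuous_on UNIV \<phi>" "\<And>x. \<bar>\<phi> x\<bar> \<le> C" "integrable lborel \<phi>"
    "(LINT x|lborel. \<bar>g x - \<phi> x\<bar>) < \<eta>"
    using integrable_approx_continuous[OF int_g \<eta>(1)] by blast
  have [measurable]: "\<phi> \<in> borel_measurable borel"
    using \<phi>(1) by (rule borel_measurable_continuous_onI)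
  define r where "r x = g x - \<phi> x" for x
  have r_meas [measurable]: "r \<in> borel_measurable borel"
    unfolding r_def[abs_def] by measurable
  have r_nn: "(\<integral>\<^sup>+x. ennreal \<bar>r x\<bar> \<partial>lborel) \<le> ennreal \<eta>"
  proof -
    have "(\<integral>\<^sup>+x. ennreal \<bar>r x\<bar> \<partial>lborel) = ennreal (LINT x|lborel. \<bar>r x\<bar>)"
      unfolding r_def by (intro nn_integral_eq_integral) (auto intro!: int_g \<phi>)
    then show ?thesis using \<phi>(4) by (simp add: r_def ennreal_leI)
  qed
  have m_leb [measurable]: "mollify a lborel h \<in> borel_measurable borel" if "h \<in> borel_measurable borel" for a h
    using that by (intro measurable_mollify) (auto intro: sigma_finite_lborel)
  have m_M [measurable]: "mollify a M h \<in> borel_measurable borel" if "h \<in> borel_measurable borel" for a h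
    using that M_is_borel by (intro measurable_mollify) (auto intro: sigma_finite_measure_axioms)
  have decomp: "mollify a M (\<lambda>_. 1) x = mollify a lborel \<phi> x + mollify a lborel r x
      + (mollify a M (indicator K) x + mollify a M (indicator (N - K)) x)" for a x
  proof -
    define k where "k y = (1 / a) * \<psi> ((x - y) / a)" for y
    have k: "integrable M k" unfolding k_def by (rule integrable_mollifier)
    have [measurable]: "k \<in> borel_measurable borel" unfolding k_def by measurable
    have ind: "integrable M (\<lambda>y. indicator S y * k y)" if "S \<in> sets borel" for S
      using integrable_mult_indicator[OF _ k, of S] that by (simp add: M_is_borel)
    have leb: "integrable lborel (\<lambda>y. h y * k y)" if "integrable lborel h" for h
    proof (rule Bochner_Integration.integrable_bound[of _ "\<lambda>y. (B / \<bar>a\<bar>) * h y"])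
      show "AE y in lborel. norm (h y * k y) \<le> norm (B / \<bar>a\<bar> * h y)"
      proof (rule AE_I2)
        fix y
        have "\<bar>k y\<bar> \<le> B / \<bar>a\<bar>"
          using kernel_bound[of "(x - y) / a"] by (simp add: k_def abs_mult divide_right_mono)
        then have "\<bar>h y\<bar> * \<bar>k y\<bar> \<le> \<bar>h y\<bar> * (B / \<bar>a\<bar>)"
          by (rule mult_left_mono) simp
        then show "norm (h y * k y) \<le> norm (B / \<bar>a\<bar> * h y)"
          using bound_nonneg by (simp add: abs_mult mult_ac)
      qed
    qed (use that borel_measurable_integrable[OF that] in auto)
    have "mollify a M (\<lambda>_. 1) x = (LINT y|lborel. g y * k y) + (LINT y|M. indicator N y * k y)"
      unfolding mollify_def k_def[symmetric] using split[OF k] by simp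
    also have "(LINT y|lborel. g y * k y) = (LINT y|lborel. \<phi> y * k y + r y * k y)"
      by (intro Bochner_Integration.integral_cong) (auto simp: r_def algebra_simps)
    also have "\<dots> = mollify a lborel \<phi> x + mollify a lborel r x"
      unfolding mollify_def k_def[symmetric] r_def
      by (intro Bochner_Integration.integral_add leb Bochner_Integration.integrable_diff int_g \<phi>)
    also have "(LINT y|M. indicator N y * k y) = (LINT y|M. indicator K y * k y + indicator (N - K) y * k y)"
      using K(2) by (intro Bochner_Integration.integral_cong) (auto split: split_indicator)
    also have "\<dots> = mollify a M (indicator K) x + mollify a M (indicator (N - K)) x"
      unfolding mollify_def k_def[symmetric]
      by (intro Bochner_Integration.integral_add ind) auto
    finally show ?thesis .
  qed
  have e4: "0 < e / 4" using e by simp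
  have "\<forall>\<^sub>F a in at_right 0. (\<integral>\<^sup>+x. ennreal (\<bar>mollify a M (\<lambda>_. 1) x - A * g x\<bar> * indicator (I - U) x) \<partial>lborel) \<le> ennreal e"
    using mollify_compact_small[OF K(1) U(1,2) t(1)] eventually_at_right_less[of 0]
      mollify_continuous_tendsto[OF \<phi>(1,2) I I_fin e4]
  proof eventually_elim
    case (elim a)
    let ?T1 = "\<lambda>x. ennreal (\<bar>mollify a lborel \<phi> x - A * \<phi> x\<bar> * indicator I x)"
    let ?T2 = "\<lambda>x. ennreal \<bar>mollify a lborel r x\<bar>"
    let ?T3 = "\<lambda>x. ennreal \<bar>A\<bar> * ennreal \<bar>r x\<bar>"
    let ?T4 = "\<lambda>x. ennreal (t * measure M UNIV) * indicator I x"
    let ?T5 = "\<lambda>x. ennreal \<bar>mollify a M (indicator (N - K)) x\<bar>"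
    have "(\<integral>\<^sup>+x. ennreal (\<bar>mollify a M (\<lambda>_. 1) x - A * g x\<bar> * indicator (I - U) x) \<partial>lborel)
      \<le> (\<integral>\<^sup>+x. ?T1 x + ?T2 x + ?T3 x + ?T4 x + ?T5 x \<partial>lborel)"
    proof (rule nn_integral_mono)
      fix x
      show "ennreal (\<bar>mollify a M (\<lambda>_. 1) x - A * g x\<bar> * indicator (I - U) x) \<le> ?T1 x + ?T2 x + ?T3 x + ?T4 x + ?T5 x"
      proof (cases "x \<in> I - U")
        case True
        have "\<bar>mollify a M (indicator K) x\<bar> \<le> t * measure M UNIV"
          using elim(1) True by auto
        moreover have "mollify a M (\<lambda>_. 1) x - A * g x = (mollify a lborel \<phi> x - A * \<phi> x) + mollify a lborel r x
          - A * r x + mollify a M (indicator K) x + mollify a M (indicator (N - K)) x"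
          unfolding decomp by (simp add: r_def algebra_simps)
        ultimately have "\<bar>mollify a M (\<lambda>_. 1) x - A * g x\<bar> \<le> \<bar>mollify a lborel \<phi> x - A * \<phi> x\<bar> + \<bar>mollify a lborel r x\<bar>
          + \<bar>A\<bar> * \<bar>r x\<bar> + t * measure M UNIV + \<bar>mollify a M (indicator (N - K)) x\<bar>"
          using abs_mult[of A "r x"] by linarith
        from ennreal_leI[OF this] show ?thesis
          using True t(1) by (simp add: ennreal_mult)
      qed simp
    qed
    also have "\<dots> = (\<integral>\<^sup>+x. ?T1 x \<partial>lborel) + (\<integral>\<^sup>+x. ?T2 x \<partial>lborel) + (\<integral>\<^sup>+x. ?T3 x \<partial>lborel)
        + (\<integral>\<^sup>+x. ?T4 x \<partial>lborel) + (\<integral>\<^sup>+x. ?T5 x \<partial>lborel)"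
      by (simp add: nn_integral_add)
    also have "\<dots> \<le> ennreal (e / 4) + ennreal (e / 8) + ennreal (e / 8) + ennreal (e / 4) + ennreal (e / 8)"
    proof (intro add_mono)
      show "(\<integral>\<^sup>+x. ?T1 x \<partial>lborel) \<le> ennreal (e / 4)"
        using elim(3) by (simp add: A_def)
      have "(\<integral>\<^sup>+x. ?T2 x \<partial>lborel) \<le> (\<integral>\<^sup>+x. ennreal \<bar>r x\<bar> \<partial>lborel) * ennreal L"
        unfolding L_def using elim(2) by (intro nn_integral_mollify_le) (auto intro: sigma_finite_lborel)
      also have "\<dots> \<le> ennreal \<eta> * ennreal L"
        by (intro mult_right_mono r_nn) auto
      also have "\<dots> \<le> ennreal (e / 8)"
        using \<eta> L by (simp add: ennreal_leI mult.commute flip: ennreal_mult)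
      finally show "(\<integral>\<^sup>+x. ?T2 x \<partial>lborel) \<le> ennreal (e / 8)" .
      have "(\<integral>\<^sup>+x. ?T3 x \<partial>lborel) = ennreal \<bar>A\<bar> * (\<integral>\<^sup>+x. ennreal \<bar>r x\<bar> \<partial>lborel)"
        by (rule nn_integral_cmult) auto
      also have "\<dots> \<le> ennreal L * ennreal \<eta>"
        using L by (intro mult_mono r_nn ennreal_leI) auto
      also have "\<dots> \<le> ennreal (e / 8)"
        using \<eta> L by (simp add: ennreal_leI flip: ennreal_mult)
      finally show "(\<integral>\<^sup>+x. ?T3 x \<partial>lborel) \<le> ennreal (e / 8)" .
      have "(\<integral>\<^sup>+x. ?T4 x \<partial>lborel) = ennreal (t * measure M UNIV) * ennreal m"
        by (simp add: nn_integral_cmult m)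
      also have "\<dots> \<le> ennreal (e / 4)"
        using t m by (simp add: ennreal_leI flip: ennreal_mult)
      finally show "(\<integral>\<^sup>+x. ?T4 x \<partial>lborel) \<le> ennreal (e / 4)" .
      have "(\<integral>\<^sup>+x. ?T5 x \<partial>lborel) \<le> (\<integral>\<^sup>+y. ennreal \<bar>indicator (N - K) y\<bar> \<partial>M) * ennreal L"
        unfolding L_def using elim(2) M_is_borel
        by (intro nn_integral_mollify_le) (auto intro: sigma_finite_measure_axioms)
      also have "(\<integral>\<^sup>+y. ennreal \<bar>indicator (N - K) y\<bar> \<partial>M) = ennreal (measure M (N - K))"
        by (simp add: ennreal_indicator M_is_borel emeasure_eq_measure)
      also have "ennreal (measure M (N - K)) * ennreal L \<le> ennreal \<eta> * ennreal L"
        using K(3) by (intro mult_right_mono ennreal_leI) auto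
      also have "\<dots> \<le> ennreal (e / 8)"
        using \<eta> L by (simp add: ennreal_leI mult.commute flip: ennreal_mult)
      finally show "(\<integral>\<^sup>+x. ?T5 x \<partial>lborel) \<le> ennreal (e / 8)" .
    qed
    also have "\<dots> = ennreal (e / 4 + e / 8 + e / 8 + e / 4 + e / 8)"
      using e by (simp flip: ennreal_plus)
    also have "\<dots> \<le> ennreal e"
      using e by (intro ennreal_leI) simp
    finally show ?case .
  qed
  then show ?thesis
    using U_small by (intro bexI[of _ U]) (auto simp: A_def g_def)
qed

theorem scaled_conv_powr_tendsto:
  assumes p: "0 < p" "p < 1"
  shows "((\<lambda>a. LBINT x:{c<..<d}. \<bar>conv_meas (\<lambda>t. (1 / a) * \<psi> (t / a)) M x\<bar> powr p)
    \<longlongrightarrow> \<bar>LINT x|lborel. \<psi> x\<bar> powr p * (LBINT x:{c<..<d}. \<bar>ac_density M x\<bar> powr p)) (at_right 0)"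
proof -
  note [measurable] = measurable_ac_density
  define A where "A = (LINT u|lborel. \<psi> u)"
  define L where "L = (LINT u|lborel. \<bar>\<psi> u\<bar>)"
  define I where "I = {c<..<d}"
  define F where "F a = mollify a M (\<lambda>_. 1)" for a
  define g where "g x = A * ac_density M x" for x
  define b where "b = measure M UNIV * L + (LINT x|lborel. \<bar>g x\<bar>)"
  have L: "0 \<le> L" by (simp add: L_def)
  have I [measurable]: "I \<in> sets borel" and I_fin: "emeasure lborel I < \<infinity>"
    by (cases "c \<le> d"; simp add: I_def)+
  have F_meas [measurable]: "F a \<in> borel_measurable borel" for a
    unfolding F_def using M_is_borel by (intro measurable_mollify) (auto intro: sigma_finite_measure_axioms)
  have g_meas [measurable]: "g \<in> borel_measurable borel"
    unfolding g_def by measurable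
  have int_g: "integrable lborel g"
    unfolding g_def by (intro integrable_mult_right integrable_ac_density)
  have small: "\<forall>\<^sub>F a in at_right 0. (\<integral>\<^sup>+x. ennreal (\<bar>F a x - g x\<bar> powr p * indicator I x) \<partial>lborel) \<le> ennreal e"
    if "0 < e" for e :: real
  proof (rule eventually_nn_integral_powr_le[where b = b, OF _ I_fin _ p _ _ that])
    show "\<forall>\<^sub>F a in at_right 0. (\<integral>\<^sup>+x. ennreal (\<bar>F a x - g x\<bar> * indicator I x) \<partial>lborel) \<le> ennreal b"
      using eventually_at_right_less[of 0]
    proof eventually_elim
      case (elim a)
      have "(\<integral>\<^sup>+x. ennreal (\<bar>F a x - g x\<bar> * indicator I x) \<partial>lborel) \<le> (\<integral>\<^sup>+x. ennreal \<bar>F a x\<bar> + ennreal \<bar>g x\<bar> \<partial>lborel)"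
        by (intro nn_integral_mono) (auto simp flip: ennreal_plus intro!: ennreal_leI split: split_indicator)
      also have "\<dots> = (\<integral>\<^sup>+x. ennreal \<bar>F a x\<bar> \<partial>lborel) + (\<integral>\<^sup>+x. ennreal \<bar>g x\<bar> \<partial>lborel)"
        by (rule nn_integral_add) auto
      also have "(\<integral>\<^sup>+x. ennreal \<bar>g x\<bar> \<partial>lborel) = ennreal (LINT x|lborel. \<bar>g x\<bar>)"
        by (intro nn_integral_eq_integral integrable_abs int_g) auto
      also have "(\<integral>\<^sup>+x. ennreal \<bar>F a x\<bar> \<partial>lborel) \<le> (\<integral>\<^sup>+y. ennreal \<bar>1\<bar> \<partial>M) * ennreal L"
        unfolding F_def L_def using elim M_is_borel
        by (intro nn_integral_mollify_le) (auto intro: sigma_finite_measure_axioms)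
      also have "\<dots> = ennreal (measure M UNIV * L)"
        using L by (simp add: emeasure_eq_measure ennreal_mult)
      finally show ?case
        using L by (simp add: b_def add_right_mono)
    qed
    show "\<exists>U\<in>sets lborel. emeasure lborel U \<le> ennreal e \<and>
      (\<forall>\<^sub>F a in at_right 0. (\<integral>\<^sup>+x. ennreal (\<bar>F a x - g x\<bar> * indicator (I - U) x) \<partial>lborel) \<le> ennreal e)"
      if "0 < e" for e :: real
      using mollify_L1_off_small_set[OF I I_fin that] by (simp add: F_def g_def A_def)
  qed auto
  have int_gp: "integrable lborel (\<lambda>x. \<bar>g x\<bar> powr p * indicator I x)"
  proof (rule Bochner_Integration.integrable_bound[of _ "\<lambda>x. indicator I x + \<bar>g x\<bar>"])
    show "AE x in lborel. norm (\<bar>g x\<bar> powr p * indicator I x) \<le> norm (indicator I x + \<bar>g x\<bar>)"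
      using powr_le_affine[of "\<bar>g x\<bar>" 1 p for x] p by (auto split: split_indicator)
  qed (use int_g I_fin in \<open>auto intro!: integrable_real_indicator\<close>)
  have int_Fp: "integrable lborel (\<lambda>x. \<bar>F a x\<bar> powr p * indicator I x)" for a
  proof (rule integrableI_bounded_set[where A = I and B = "((1 / \<bar>a\<bar>) * (B * measure M UNIV)) powr p"])
    have "\<bar>F a x\<bar> \<le> (1 / \<bar>a\<bar>) * (B * measure M UNIV)" for x
    proof -
      have "F a x = (1 / a) * scaled_conv a x"
        by (simp add: F_def mollify_def conv_meas_def)
      then show ?thesis
        using mult_left_mono[OF scaled_conv_bound[of a x], of "1 / \<bar>a\<bar>"] by (simp add: abs_mult)
    qed
    then show "AE x in lborel. x \<in> I \<longrightarrow> norm (\<bar>F a x\<bar> powr p * indicator I x) \<le> ((1 / \<bar>a\<bar>) * (B * measure M UNIV)) powr p"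
      using p by (auto intro!: AE_I2 powr_mono2)
  qed (use I_fin in auto)
  have "((\<lambda>a. LINT x|lborel. \<bar>F a x\<bar> powr p * indicator I x) \<longlongrightarrow> (LINT x|lborel. \<bar>g x\<bar> powr p * indicator I x)) (at_right 0)"
  proof (rule tendstoI)
    fix e :: real assume e: "0 < e"
    then have "0 < e / 2" by simp
    from small[OF this] show "\<forall>\<^sub>F a in at_right 0. dist (LINT x|lborel. \<bar>F a x\<bar> powr p * indicator I x)
        (LINT x|lborel. \<bar>g x\<bar> powr p * indicator I x) < e"
    proof eventually_elim
      case (elim a)
      have "ennreal (dist (LINT x|lborel. \<bar>F a x\<bar> powr p * indicator I x) (LINT x|lborel. \<bar>g x\<bar> powr p * indicator I x))
        = ennreal (norm (LINT x|lborel. \<bar>F a x\<bar> powr p * indicator I x - \<bar>g x\<bar> powr p * indicator I x))"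
        by (simp add: dist_norm Bochner_Integration.integral_diff[OF int_Fp int_gp])
      also have "\<dots> \<le> (\<integral>\<^sup>+x. ennreal (norm (\<bar>F a x\<bar> powr p * indicator I x - \<bar>g x\<bar> powr p * indicator I x)) \<partial>lborel)"
        by (intro integral_norm_bound_ennreal Bochner_Integration.integrable_diff int_Fp int_gp)
      also have "\<dots> \<le> (\<integral>\<^sup>+x. ennreal (\<bar>F a x - g x\<bar> powr p * indicator I x) \<partial>lborel)"
        by (intro nn_integral_mono ennreal_leI) (auto intro!: abs_powr_diff_le p split: split_indicator)
      also have "\<dots> \<le> ennreal (e / 2)" by (rule elim)
      finally show ?case
        using e by (simp add: ennreal_le_iff)
    qed
  qed
  moreover have "(LINT x|lborel. \<bar>g x\<bar> powr p * indicator I x) = \<bar>A\<bar> powr p * (LBINT x:I. \<bar>ac_density M x\<bar> powr p)"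
    unfolding set_lebesgue_integral_def integral_mult_right_zero[symmetric]
    by (intro Bochner_Integration.integral_cong) (auto simp: g_def abs_mult powr_mult)
  moreover have "(LINT x|lborel. \<bar>F a x\<bar> powr p * indicator I x) = (LBINT x:I. \<bar>F a x\<bar> powr p)" for a
    by (simp add: set_lebesgue_integral_def mult.commute)
  ultimately show ?thesis
    unfolding conv_meas_eq_mollify by (simp add: F_def A_def I_def)
qed

end

section \<open>Kernels with polynomial decay\<close>

lemma integrable_one_plus_abs_powr:
  fixes \<delta> :: real
  assumes "1 < \<delta>"
  shows "integrable lborel (\<lambda>x. (1 + \<bar>x\<bar>) powr (- \<delta>))"
proof (rule integrableI_bounded)
  define f :: "real \<Rightarrow> ennreal" where "f x = ennreal ((1 + \<bar>x\<bar>) powr (- \<delta>))" for x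
  have [measurable]: "f \<in> borel_measurable borel"
    unfolding f_def by measurable
  have "(\<integral>\<^sup>+x. f x * indicator {0..} x \<partial>lborel) = ennreal (0 - - ((1 + 0) powr (1 - \<delta>) / (\<delta> - 1)))"
    unfolding f_def
  proof (rule nn_integral_FTC_atLeast)
    have "((\<lambda>x. (1 + x) powr (1 - \<delta>)) \<longlongrightarrow> 0) at_top"
      using assms by (intro tendsto_neg_powr filterlim_tendsto_add_at_top[OF tendsto_const filterlim_ident]) auto
    then show "((\<lambda>x. - ((1 + x) powr (1 - \<delta>) / (\<delta> - 1))) \<longlongrightarrow> 0) at_top"
      using tendsto_minus[OF tendsto_divide_zero] by force
    show "((\<lambda>x. - ((1 + x) powr (1 - \<delta>) / (\<delta> - 1))) has_real_derivative (1 + \<bar>x\<bar>) powr (- \<delta>)) (at x)"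
      if "0 \<le> x" for x
      using that assms by (auto intro!: derivative_eq_intros simp: divide_simps) (simp add: algebra_simps)
  qed auto
  then have fin: "(\<integral>\<^sup>+x. f x * indicator {0..} x \<partial>lborel) < \<infinity>"
    by simp
  have "(\<integral>\<^sup>+x. f x * indicator {..0} x \<partial>lborel) = (\<integral>\<^sup>+x. f x * indicator {0..} x \<partial>lborel)"
    by (subst nn_integral_real_affine[where c = "-1" and t = 0])
      (auto simp: f_def intro!: nn_integral_cong split: split_indicator)
  moreover have "(\<integral>\<^sup>+x. f x \<partial>lborel) \<le> (\<integral>\<^sup>+x. f x * indicator {0..} x + f x * indicator {..0} x \<partial>lborel)"
    by (intro nn_integral_mono) (auto split: split_indicator)
  moreover have "\<dots> = (\<integral>\<^sup>+x. f x * indicator {0..} x \<partial>lborel) + (\<integral>\<^sup>+x. f x * indicator {..0} x \<partial>lborel)"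
    by (rule nn_integral_add) auto
  ultimately have "(\<integral>\<^sup>+x. f x \<partial>lborel) < \<infinity>"
    using fin by (simp add: order.strict_trans1)
  then show "(\<integral>\<^sup>+x. ennreal (norm ((1 + \<bar>x\<bar>) powr (- \<delta>))) \<partial>lborel) < \<infinity>"
    by (simp add: f_def)
qed simp

lemma jbr_powr_le:
  assumes "0 \<le> \<delta>"
  shows "jbr x powr (- \<delta>) \<le> 2 powr \<delta> * (1 + \<bar>x\<bar>) powr (- \<delta>)"
proof -
  have "(1 + \<bar>x\<bar>) / 2 \<le> jbr x"
    unfolding jbr_def
  proof (rule real_le_rsqrt)
    show "((1 + \<bar>x\<bar>) / 2)\<^sup>2 \<le> 1 + x\<^sup>2"
      using zero_le_power2[of "1 - \<bar>x\<bar>"] zero_le_power2[of x]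
      by (simp add: power2_eq_square algebra_simps)
  qed
  then have "jbr x powr (- \<delta>) \<le> ((1 + \<bar>x\<bar>) / 2) powr (- \<delta>)"
    using assms by (intro powr_mono2') auto
  then show ?thesis
    by (simp add: powr_divide powr_minus field_simps)
qed

lemma scaling_kernel_of_decay:
  assumes cont: "continuous_on UNIV \<psi>" and \<delta>: "1 < \<delta>" and C: "0 \<le> C"
    and decay: "\<And>x. \<bar>\<psi> x\<bar> \<le> C * jbr x powr (- \<delta>)"
  shows "scaling_kernel \<psi> (C * 2 powr \<delta>)"
proof -
  define D where "D = C * 2 powr \<delta>"
  have D: "0 \<le> D" using C by (simp add: D_def)
  have le: "\<bar>\<psi> x\<bar> \<le> D * (1 + \<bar>x\<bar>) powr (- \<delta>)" for x
    using decay[of x] mult_left_mono[OF jbr_powr_le C, of \<delta> x] \<delta> by (simp add: D_def mult.assoc)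
  have "scaling_kernel \<psi> D"
  proof
    show "\<bar>\<psi> x\<bar> \<le> D" for x
    proof -
      have "(1 + \<bar>x\<bar>) powr (- \<delta>) \<le> 1"
        using powr_mono2'[of "- \<delta>" 1 "1 + \<bar>x\<bar>"] \<delta> by simp
      from mult_left_mono[OF this D] le[of x] show ?thesis by linarith
    qed
    have [measurable]: "\<psi> \<in> borel_measurable borel"
      using cont by (rule borel_measurable_continuous_onI)
    show "integrable lborel \<psi>"
    proof (rule Bochner_Integration.integrable_bound)
      show "integrable lborel (\<lambda>x. D * (1 + \<bar>x\<bar>) powr (- \<delta>))"
        by (intro integrable_mult_right integrable_one_plus_abs_powr \<delta>)
      show "AE x in lborel. norm (\<psi> x) \<le> norm (D * (1 + \<bar>x\<bar>) powr (- \<delta>))"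
        using order.trans[OF le abs_ge_self] by auto
    qed simp
    have "((\<lambda>t. D * (1 + t) powr (1 - \<delta>)) \<longlongrightarrow> 0) at_top"
      using \<delta> by (intro tendsto_mult_right_zero tendsto_neg_powr
        filterlim_tendsto_add_at_top[OF tendsto_const filterlim_ident]) auto
    from filterlim_compose[OF this filterlim_norm_at_top[where 'a = real]]
    have "((\<lambda>x::real. D * (1 + \<bar>x\<bar>) powr (1 - \<delta>)) \<longlongrightarrow> 0) at_infinity"
      by simp
    then show "((\<lambda>x. x * \<psi> x) \<longlongrightarrow> 0) at_infinity"
    proof (rule Lim_null_comparison[rotated])
      have "norm (x * \<psi> x) \<le> D * (1 + \<bar>x\<bar>) powr (1 - \<delta>)" for x
      proof -
        have "\<bar>x\<bar> * \<bar>\<psi> x\<bar> \<le> (1 + \<bar>x\<bar>) * (D * (1 + \<bar>x\<bar>) powr (- \<delta>))"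
          by (intro mult_mono le) auto
        also have "\<dots> = D * ((1 + \<bar>x\<bar>) * (1 + \<bar>x\<bar>) powr (- \<delta>))"
          by (simp add: mult_ac)
        also have "(1 + \<bar>x\<bar>) * (1 + \<bar>x\<bar>) powr (- \<delta>) = (1 + \<bar>x\<bar>) powr (1 - \<delta>)"
          by (subst powr_mult_base) auto
        finally show ?thesis by (simp add: abs_mult)
      qed
      then show "\<forall>\<^sub>F x in at_infinity. norm (x * \<psi> x) \<le> D * (1 + \<bar>x\<bar>) powr (1 - \<delta>)"
        by simp
    qed
  qed (fact cont)
  then show ?thesis by (simp add: D_def)
qed

theorem theorem2p4:
  fixes \<psi> \<psi>' :: "real \<Rightarrow> real" and M :: "real measure" and c d :: real
  assumes deriv: "\<And>x. (\<psi> has_real_derivative \<psi>' x) (at x)"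
    and cont_deriv: "continuous_on UNIV \<psi>'"
    and psi0: "\<psi> 0 = 1"
    and even: "\<And>x. \<psi> (- x) = \<psi> x"
    and decay: "\<exists>C>0. \<exists>\<delta>>1. \<forall>x. \<bar>\<psi> x\<bar> + \<bar>x * \<psi>' x\<bar> \<le> C * jbr x powr (- \<delta>)"
    and A_nonzero: "(LINT x|lborel. \<psi> x) \<noteq> 0"
    and prob: "prob_space M" and sets_M: "sets M = sets borel"
    and cd: "c < d"
  shows "((\<lambda>a. (1 / a) * (LBINT x:{c<..<d}. (conv_meas (\<lambda>t. \<psi> (t / a)) M x)\<^sup>2))
            \<longlongrightarrow> (LINT x|lborel. (\<psi> x)\<^sup>2) *
                 ((\<Sum>\<^sub>\<infinity>x\<in>{c<..<d}. (measure M {x})\<^sup>2)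
                  + 1/2 * ((measure M {c})\<^sup>2 + (measure M {d})\<^sup>2))) (at_right 0)
    \<and> (\<forall>p. 0 < p \<and> p < 1 \<longrightarrow>
         ((\<lambda>a. LBINT x:{c<..<d}. \<bar>conv_meas (\<lambda>t. (1 / a) * \<psi> (t / a)) M x\<bar> powr p)
            \<longlongrightarrow> \<bar>LINT x|lborel. \<psi> x\<bar> powr p *
                 (LBINT x:{c<..<d}. \<bar>ac_density M x\<bar> powr p)) (at_right 0))"
proof -
  obtain C \<delta> where C: "C > 0" and \<delta>: "\<delta> > 1"
    and bound: "\<And>x. \<bar>\<psi> x\<bar> + \<bar>x * \<psi>' x\<bar> \<le> C * jbr x powr (- \<delta>)"
    using decay by blast
  have "continuous_on UNIV \<psi>"
    using deriv by (auto intro!: continuous_at_imp_continuous_on DERIV_isCont)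
  moreover have "\<bar>\<psi> x\<bar> \<le> C * jbr x powr (- \<delta>)" for x
    using bound[of x] by linarith
  ultimately interpret scaling_kernel \<psi> "C * 2 powr \<delta>"
    using C \<delta> by (intro scaling_kernel_of_decay) auto
  interpret prob_space M by fact
  interpret finite_borel_measure M
    by unfold_locales (fact sets_M)
  interpret kernel_convolution \<psi> "C * 2 powr \<delta>" M ..
  show ?thesis
    using scaled_conv_square_tendsto[OF even cd] scaled_conv_powr_tendsto by blast
qed

end
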